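(* Let $H$ be an arbitrary positive selfadjoint operator in a Hilbert space $\mathcal{H}_0$ for which $0$ is not an eigenvalue. (1) $(\mathcal{D}(H^{1/2});\mathcal{H}_0;\mathcal{R}(H^{1/2}))$ is a triplet of closely embedded Hilbert spaces such that $H$ is its Hamiltonian. (2) Let $(\mathcal{H}_+;\mathcal{H}_0;\mathcal{H}_-)$ be any other triplet of closely embedded Hilbert spaces with the same Hamiltonian $H$, and let $j_+$ denote the closed embedding of $\mathcal{H}_+$ in $\mathcal{H}_0$. Then: (a) $\operatorname{Dom}(H^{1/2})$ is dense in both $\mathcal{D}(H^{1/2})$ and $\mathcal{H}_+$. (b) For any $x\in\operatorname{Dom}(H^{1/2})$ and any $y\in\operatorname{Dom}(H)$ we have $\langle x,Hy\rangle_{\mathcal{H}_0}=\langle x,y\rangle_+=(x,y)_{H^{1/2}}$. (c) $\operatorname{Dom}(H)$ is dense in both $\mathcal{D}(H^{1/2})$ and $\mathcal{H}_+$. (d) For any $x\in\operatorname{Dom}(j_+)=\operatorname{Dom}(H^{1/2})$ we have $$\|x\|_+=\sup\Bigl\{\frac{|\langle x,H^{1/2}z\rangle_{\mathcal{H}_0}|}{\|z\|_{\mathcal{H}_0}}\;\Big|\; z\in\operatorname{Dom}(H^{1/2}),\ z\ne0\Bigr\}.$$ (e) The identity operator $\operatorname{Dom}(H)\,(\subseteq\mathcal{D}(H^{1/2}))\to\mathcal{H}_+$ extends uniquely to a unitary operator $\Phi_+\colon\mathcal{D}(H^{1/2})\to\mathcal{H}_+$ such that $\Phi_+y=j_+^*Hy$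 for all $y\in\operatorname{Dom}(H)$.
   Context: All Hilbert spaces are complex, with inner products linear in the first variable; operators may be unbounded. "Positive" means $\langle Hx,x\rangle\ge0$ on the domain. For an injective operator $S$, $S^{-1}$ is its algebraic inverse, with $\operatorname{Dom}(S^{-1})=\operatorname{Ran}(S)$. A Hilbert space $\mathcal{K}$ is closely embedded in a Hilbert space $\mathcal{H}$ if there is a linear manifold $\mathcal{D}\subseteq\mathcal{K}\cap\mathcal{H}$ (on which the algebraic structures of $\mathcal{K}$ and $\mathcal{H}$ agree), dense in $\mathcal{K}$, such that the embedding operator $j$ with $\operatorname{Dom}(j)=\mathcal{D}$, $jx=x$, is closed as an operator from $\mathcal{K}$ to $\mathcal{H}$; $j$ is called the closed embedding. $(\mathcal{H}_+;\mathcal{H}_0;\mathcal{H}_-)$ is a triplet of closely embedded Hilbert spaces if: (th1) $\mathcal{H}_+$ is closely embedded in $\mathcal{H}_0$, with closed embedding $j_+$, and $\operatorname{Ran}(j_+)$ is dense in $\mathcal{H}_0$; (th2) $\mathcal{H}_0$ is closely embedded in $\mathcal{H}_-$, with closed embedding $j_-$, and $\operatorname{Ran}(j_-)$ is dense in $\mathcal{H}_-$; (th3) $\operatorname{Dom}(j_+^* )\subseteq\operatorname{Dom}(j_-)$ and for every $y\in\operatorname{Dom}(j_-)\subseteq\mathcal{H}_0$, $$\|y\|_-=\sup\Bigl\{\frac{|\langle x,y\rangle_{\mathcal{H}_0}|}{\|x\|_+}\;\Big|\; x\in\operatorname{Dom}(j_+),\ x\ne0\Bigr\}.$$ The kernel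 operator of the triplet is $A=j_+j_+^*$ (a one-to-one positive selfadjoint operator in $\mathcal{H}_0$), and its Hamiltonian is $A^{-1}$. Vectors of $\operatorname{Dom}(j_+)\subseteq\mathcal{H}_+$ are identified with their images in $\mathcal{H}_0$. The space $\mathcal{D}(H^{1/2})$ is the Hilbert space completion of $\operatorname{Dom}(H^{1/2})$ with respect to the norm $|x|_{H^{1/2}}=\|H^{1/2}x\|_{\mathcal{H}_0}$, with inner product $(x,y)_{H^{1/2}}=\langle H^{1/2}x,H^{1/2}y\rangle_{\mathcal{H}_0}$; its closed embedding in $\mathcal{H}_0$ has domain $\operatorname{Dom}(H^{1/2})$ and acts as $x\mapsto x$. The space $\mathcal{R}(H^{1/2})$ is the Hilbert space completion of $\operatorname{Ran}(H^{1/2})$ with respect to the inner product $\langle H^{1/2}x,H^{1/2}y\rangle_{\mathcal{R}(H^{1/2})}=\langle x,y\rangle_{\mathcal{H}_0}$, $x,y\in\operatorname{Dom}(H^{1/2})$; the closed embedding of $\mathcal{H}_0$ in $\mathcal{R}(H^{1/2})$ has domain $\operatorname{Ran}(H^{1/2})\subseteq\mathcal{H}_0$ and acts as $u\mapsto u$. *)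

theory Defs
  imports "HOL-Analysis.Analysis"
begin

text \<open>
  A complex Hilbert space is a complete real inner product space with a compatible complex
  structure; norm and topology are those of the real space, so that
  \<open>cinner x x = norm x ^ 2\<close>. The inner product is linear in its first argument.
\<close>

class chilbert_space = real_inner + complete_space +
  fixes scaleC :: "complex \<Rightarrow> 'a \<Rightarrow> 'a"  (infixr "*\<^sub>C" 75)
    and cinner :: "'a \<Rightarrow> 'a \<Rightarrow> complex"
  assumes scaleC_add_right: "c *\<^sub>C (x + y) = c *\<^sub>C x + c *\<^sub>C y"
    and scaleC_add_left: "(c + d) *\<^sub>C x = c *\<^sub>C x + d *\<^sub>C x"
    and scaleC_scaleC: "c *\<^sub>C d *\<^sub>C x = (c * d) *\<^sub>C x"
    and scaleC_of_real: "complex_of_real r *\<^sub>C x = r *\<^sub>R x"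
    and cinner_add_left: "cinner (x + y) z = cinner x z + cinner y z"
    and cinner_scaleC_left: "cinner (c *\<^sub>C x) y = c * cinner x y"
    and cinner_commute: "cinner x y = cnj (cinner y x)"
    and inner_eq_Re_cinner: "inner x y = Re (cinner x y)"

text \<open>
  An operator \<open>T\<close> from \<open>'a\<close> to \<open>'b\<close> is represented by its graph, a subset of \<open>'a \<times> 'b\<close>. Hence
  equality of operators includes equality of domains, \<open>Domain T\<close> and \<open>Range T\<close> are the domain
  and the range, \<open>T\<inverse>\<close> is the algebraic inverse, \<open>S O T\<close> is the composition ``first \<open>S\<close>,
  then \<open>T\<close>'' on its maximal domain, and \<open>T\<close> is a closed operator iff \<open>closed T\<close>.
\<close>

definition linear_op :: "('a::chilbert_space \<times> 'b::chilbert_space) set \<Rightarrow> bool" where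
  "linear_op T \<longleftrightarrow> single_valued T \<and> (0, 0) \<in> T
     \<and> (\<forall>(x, u) \<in> T. \<forall>(y, v) \<in> T. (x + y, u + v) \<in> T)
     \<and> (\<forall>c. \<forall>(x, u) \<in> T. (c *\<^sub>C x, c *\<^sub>C u) \<in> T)"

text \<open>The value \<open>T x\<close>; meaningful only for \<open>x \<in> Domain T\<close>.\<close>

definition op_app :: "('a \<times> 'b) set \<Rightarrow> 'a \<Rightarrow> 'b" where
  "op_app T x = (THE u. (x, u) \<in> T)"

definition densely_defined :: "('a::chilbert_space \<times> 'b) set \<Rightarrow> bool" where
  "densely_defined T \<longleftrightarrow> closure (Domain T) = UNIV"

text \<open>For densely defined \<open>T\<close> this is the graph of the usual adjoint.\<close>

definition adjoint_op ::
    "('a::chilbert_space \<times> 'b::chilbert_space) set \<Rightarrow> ('b \<times> 'a) set" where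
  "adjoint_op T = {(y, z). \<forall>(x, u) \<in> T. cinner u y = cinner x z}"

definition selfadjoint_op :: "('a::chilbert_space \<times> 'a) set \<Rightarrow> bool" where
  "selfadjoint_op T \<longleftrightarrow> linear_op T \<and> densely_defined T \<and> adjoint_op T = T"

definition positive_op :: "('a::chilbert_space \<times> 'a) set \<Rightarrow> bool" where
  "positive_op T \<longleftrightarrow> (\<forall>(x, u) \<in> T. cinner u x \<in> \<real>\<^sub>\<ge>\<^sub>0)"

definition eigenvalue_op :: "('a::chilbert_space \<times> 'a) set \<Rightarrow> complex \<Rightarrow> bool" where
  "eigenvalue_op T c \<longleftrightarrow> (\<exists>x. x \<noteq> 0 \<and> (x, c *\<^sub>C x) \<in> T)"

text \<open>\<open>H\<^sup>1\<^sup>/\<^sup>2\<close>: the unique positive selfadjoint square root of a positive selfadjoint operator.\<close>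

definition sqrt_op :: "('a::chilbert_space \<times> 'a) set \<Rightarrow> ('a \<times> 'a) set" where
  "sqrt_op H = (THE S. selfadjoint_op S \<and> positive_op S \<and> S O S = H)"

definition unitary_map :: "('a::chilbert_space \<Rightarrow> 'b::chilbert_space) \<Rightarrow> bool" where
  "unitary_map U \<longleftrightarrow> (\<forall>x y. U (x + y) = U x + U y) \<and> (\<forall>c x. U (c *\<^sub>C x) = c *\<^sub>C U x)
     \<and> (\<forall>x y. cinner (U x) (U y) = cinner x y) \<and> surj U"

text \<open>
  Different Hilbert spaces are different types, so the intersection of \<open>'k\<close> and \<open>'h\<close> containing
  the linear manifold \<open>Domain j\<close> is given by the identification of \<open>x \<in> Domain j\<close> in \<open>'k\<close> with
  \<open>j x\<close> in \<open>'h\<close>. That the algebraic structures agree and that \<open>j\<close> acts as the identity means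
  precisely that \<open>j\<close> is linear and injective.
\<close>

definition closed_embedding :: "('k::chilbert_space \<times> 'h::chilbert_space) set \<Rightarrow> bool" where
  "closed_embedding j \<longleftrightarrow>
     linear_op j \<and> single_valued (j\<inverse>) \<and> densely_defined j \<and> closed j"

text \<open>
  The supremum is taken in \<open>[0, \<infinity>]\<close>, so the equation includes its finiteness, and the
  supremum of the empty set (all spaces trivial) is \<open>0\<close>.
\<close>

definition ce_triplet ::
    "('p::chilbert_space \<times> 'h::chilbert_space) set \<Rightarrow> ('h \<times> 'm::chilbert_space) set \<Rightarrow> bool" where
  "ce_triplet jp jm \<longleftrightarrow>
     closed_embedding jp \<and> closure (Range jp) = UNIV
     \<and> closed_embedding jm \<and> closure (Range jm) = UNIV
     \<and> Domain (adjoint_op jp) \<subseteq> Domain jm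
     \<and> (\<forall>(y, v) \<in> jm. ennreal (norm v) =
          (SUP (x, u) \<in> {(x, u) \<in> jp. x \<noteq> 0}. ennreal (cmod (cinner u y) / norm x)))"

definition kernel_op :: "('p::chilbert_space \<times> 'h::chilbert_space) set \<Rightarrow> ('h \<times> 'h) set" where
  "kernel_op jp = adjoint_op jp O jp"

definition hamiltonian :: "('p::chilbert_space \<times> 'h::chilbert_space) set \<Rightarrow> ('h \<times> 'h) set" where
  "hamiltonian jp = (kernel_op jp)\<inverse>"

text \<open>
  A set \<open>V\<close> of vectors of \<open>'h\<close>, regarded through the embedding \<open>j\<close> as a set of vectors
  of \<open>'k\<close>, is contained in and dense in \<open>'k\<close>.
\<close>

definition dense_via :: "('k::chilbert_space \<times> 'h) set \<Rightarrow> 'h set \<Rightarrow> bool" where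
  "dense_via j V \<longleftrightarrow> V \<subseteq> Range j \<and> closure (j\<inverse> `` V) = UNIV"

text \<open>
  The Hilbert space \<open>'k\<close> together with the canonical map \<open>i\<close> is a completion of the linear
  manifold \<open>V\<close> equipped with the inner product \<open>ip\<close>. Only the values of \<open>i\<close> on \<open>V\<close> matter.
\<close>

definition hilbert_completion ::
    "'v::chilbert_space set \<Rightarrow> ('v \<Rightarrow> 'v \<Rightarrow> complex) \<Rightarrow> ('v \<Rightarrow> 'k::chilbert_space) \<Rightarrow> bool" where
  "hilbert_completion V ip i \<longleftrightarrow>
     (\<forall>x\<in>V. \<forall>y\<in>V. i (x + y) = i x + i y) \<and> (\<forall>c. \<forall>x\<in>V. i (c *\<^sub>C x) = c *\<^sub>C i x)
     \<and> (\<forall>x\<in>V. \<forall>y\<in>V. cinner (i x) (i y) = ip x y)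
     \<and> closure (i ` V) = UNIV"

definition D_inner :: "('h::chilbert_space \<times> 'h) set \<Rightarrow> 'h \<Rightarrow> 'h \<Rightarrow> complex" where
  "D_inner H x y = cinner (op_app (sqrt_op H) x) (op_app (sqrt_op H) y)"

text \<open>On \<open>Ran(H\<^sup>1\<^sup>/\<^sup>2)\<close>; the inner product of \<open>H\<^sup>1\<^sup>/\<^sup>2 x\<close> and \<open>H\<^sup>1\<^sup>/\<^sup>2 y\<close> is \<open>cinner x y\<close>.\<close>

definition R_inner :: "('h::chilbert_space \<times> 'h) set \<Rightarrow> 'h \<Rightarrow> 'h \<Rightarrow> complex" where
  "R_inner H u v = cinner (op_app ((sqrt_op H)\<inverse>) u) (op_app ((sqrt_op H)\<inverse>) v)"

definition D_completion ::
    "('h::chilbert_space \<times> 'h) set \<Rightarrow> ('h \<Rightarrow> 'd::chilbert_space) \<Rightarrow> bool" where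
  "D_completion H i \<longleftrightarrow> hilbert_completion (Domain (sqrt_op H)) (D_inner H) i"

definition R_completion ::
    "('h::chilbert_space \<times> 'h) set \<Rightarrow> ('h \<Rightarrow> 'r::chilbert_space) \<Rightarrow> bool" where
  "R_completion H k \<longleftrightarrow> hilbert_completion (Range (sqrt_op H)) (R_inner H) k"

definition D_embedding ::
    "('h::chilbert_space \<times> 'h) set \<Rightarrow> ('h \<Rightarrow> 'd::chilbert_space) \<Rightarrow> ('d \<times> 'h) set" where
  "D_embedding H i = {(i x, x) | x. x \<in> Domain (sqrt_op H)}"

definition R_embedding ::
    "('h::chilbert_space \<times> 'h) set \<Rightarrow> ('h \<Rightarrow> 'r::chilbert_space) \<Rightarrow> ('h \<times> 'r) set" where
  "R_embedding H k = {(u, k u) | u. u \<in> Range (sqrt_op H)}"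

text \<open>
  Such completions exist, already on the type \<open>'h\<close>: apply the following lemma to \<open>H\<^sup>1\<^sup>/\<^sup>2\<close> and
  to its inverse, both of which have dense range if \<open>0\<close> is not an eigenvalue of \<open>H\<close>.
\<close>

lemma op_app_eq:
  assumes "single_valued T" "(x, u) \<in> T"
  shows "op_app T x = u"
  using assms unfolding op_app_def single_valued_def by blast

lemma hilbert_completion_op_app:
  fixes T :: "('h::chilbert_space \<times> 'k::chilbert_space) set"
  assumes lin: "linear_op T" and dense: "closure (Range T) = UNIV"
  shows "hilbert_completion (Domain T) (\<lambda>x y. cinner (op_app T x) (op_app T y)) (op_app T)"
proof -
  have sv: "single_valued T"
    using lin by (simp add: linear_op_def)
  have "op_app T ` Domain T = Range T"
  proof
    show "op_app T ` Domain T \<subseteq> Range T"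
      using op_app_eq[OF sv] by (metis DomainE Range.intros image_subsetI)
    show "Range T \<subseteq> op_app T ` Domain T"
      using op_app_eq[OF sv] by (metis Domain.intros RangeE image_eqI subsetI)
  qed
  moreover have "op_app T (x + y) = op_app T x + op_app T y"
    if xy: "x \<in> Domain T" "y \<in> Domain T" for x y
  proof -
    obtain u v where uv: "(x, u) \<in> T" "(y, v) \<in> T"
      using xy by blast
    then have "(x + y, u + v) \<in> T"
      using lin by (auto simp: linear_op_def)
    with uv show ?thesis
      by (simp add: op_app_eq[OF sv])
  qed
  moreover have "op_app T (c *\<^sub>C x) = c *\<^sub>C op_app T x" if x: "x \<in> Domain T" for c x
  proof -
    obtain u where u: "(x, u) \<in> T"
      using x by blast
    then have "(c *\<^sub>C x, c *\<^sub>C u) \<in> T"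
      using lin by (auto simp: linear_op_def)
    with u show ?thesis
      by (simp add: op_app_eq[OF sv])
  qed
  ultimately show ?thesis
    using dense by (simp add: hilbert_completion_def)
qed

end

theory Submission
  imports Defs
begin

text \<open>
  By \<open>cinner x y = Complex (x \<bullet> y) (x \<bullet> \<i> *\<^sub>C y)\<close>, the adjoint of a complex linear operator is already
  determined by the real inner product, so the operator theory takes place in real Hilbert spaces.
  Projecting \<open>(h, 0)\<close> onto the graph of a closed \<open>T\<close> shows that \<open>1 + T\<^sup>*T\<close> is onto, hence that
  \<open>Dom (T\<^sup>*T)\<close> is a core of \<open>T\<close>. For \<open>J\<close> inverse to \<open>j\<^sub>+\<close> the Hamiltonian is \<open>J\<^sup>*J\<close>, so
  \<open>J\<^sup>*J = H = S\<^sup>*S\<close> with \<open>S = H\<^sup>1\<^sup>/\<^sup>2\<close>; comparing both on the common core \<open>Dom H\<close> gives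
  \<open>Dom J = Dom S\<close> and \<open>\<parallel>J x\<parallel> = \<parallel>S x\<parallel>\<close>, from which all claims about \<open>\<H>\<^sub>+\<close> follow.
\<close>

section \<open>Closed operators between real Hilbert spaces\<close>

text \<open>\<open>sqrt_op\<close> is a definite description, so nothing can be said about
  \<open>H\<^sup>1\<^sup>/\<^sup>2\<close> before existence and uniqueness of the root are proved.
  No spectral theorem is used. \<open>H\<close> is unbounded and may have 0 in its continuous
  spectrum, so the work is moved to \<open>B = (1 + H)\<^sup>-\<^sup>1\<close>, which satisfies 0
  \<le> B \<le> 1; roots of such operators come from an iteration dominated by a scalar one, and
  graphs carry them back to unbounded operators. Passing to real spaces loses complex homogeneity of
  the root; it returns because the root commutes with every bounded operator that commutes with
  \<open>H\<close>, in particular with complex scalars. \<open>J\<close> and \<open>S\<close> take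
  values in different Hilbert spaces, so only norms of their values can be compared, and a priori
  only on \<open>Dom H\<close>. That is why a core theorem for arbitrary closed operators is needed,
  not merely one for selfadjoint operators.\<close>

lemma closed_subspace_decomposition:
  fixes M :: "'a::{real_inner,complete_space} set"
  assumes M: "subspace M" "closed M"
  obtains m where "m \<in> M" "\<And>n. n \<in> M \<Longrightarrow> (x - m) \<bullet> n = 0"
proof -
  define D where "D = (INF y\<in>M. (norm (x - y))\<^sup>2)"
  have ne: "M \<noteq> {}"
    using subspace_0[OF M(1)] by auto
  have bdd: "bdd_below ((\<lambda>y. (norm (x - y))\<^sup>2) ` M)"
    by (rule bdd_belowI[of _ 0]) auto
  have D_le: "D \<le> (norm (x - y))\<^sup>2" if "y \<in> M" for y
    unfolding D_def by (rule cINF_lower[OF bdd that])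
  have "\<exists>y\<in>M. (norm (x - y))\<^sup>2 < D + e" if "e > 0" for e
    using that cINF_less_iff[OF ne bdd, of "D + e"] by (auto simp: D_def)
  then have "\<exists>y\<in>M. (norm (x - y))\<^sup>2 < D + inverse (real (Suc n))" for n
    by simp
  then obtain y where y: "\<And>n. y n \<in> M" "\<And>n. (norm (x - y n))\<^sup>2 < D + inverse (real (Suc n))"
    by metis
  have dist_y: "(norm (y m - y n))\<^sup>2 \<le> 2 * inverse (real (Suc m)) + 2 * inverse (real (Suc n))" for m n
  proof -
    \<comment> \<open>The midpoint again has squared distance at least \<open>D\<close> from
      \<open>x\<close>, so the parallelogram law makes near-minimisers close to each other.\<close>
    have "(1/2) *\<^sub>R (y m + y n) \<in> M"
      using M(1) y(1) by (simp add: subspace_add subspace_scale)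
    then have "D \<le> (norm (x - (1/2) *\<^sub>R (y m + y n)))\<^sup>2"
      by (rule D_le)
    moreover have "(norm (y m - y n))\<^sup>2 + 4 * (norm (x - (1/2) *\<^sub>R (y m + y n)))\<^sup>2
        = 2 * (norm (x - y m))\<^sup>2 + 2 * (norm (x - y n))\<^sup>2"
      unfolding power2_norm_eq_inner
      by (simp add: inner_diff_left inner_diff_right inner_add_left inner_add_right inner_commute algebra_simps)
    ultimately show ?thesis
      using y(2)[of m] y(2)[of n] by linarith
  qed
  have "Cauchy y"
  proof (rule metric_CauchyI)
    fix e :: real assume e: "e > 0"
    obtain N where N: "inverse (real (Suc N)) < e\<^sup>2 / 4"
      using reals_Archimedean[of "e\<^sup>2 / 4"] e by auto
    have "dist (y m) (y n) < e" if "m \<ge> N" "n \<ge> N" for m n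
    proof -
      have "inverse (real (Suc m)) \<le> inverse (real (Suc N))" "inverse (real (Suc n)) \<le> inverse (real (Suc N))"
        using that by auto
      then have "(norm (y m - y n))\<^sup>2 < e\<^sup>2"
        using dist_y[of m n] N by linarith
      then show ?thesis
        using e power_less_imp_less_base[of _ 2 e] by (simp add: dist_norm)
    qed
    then show "\<exists>N. \<forall>m\<ge>N. \<forall>n\<ge>N. dist (y m) (y n) < e"
      by blast
  qed
  then obtain m where m: "y \<longlonglongrightarrow> m"
    using Cauchy_convergent convergent_def by blast
  have "m \<in> M"
    using closed_sequentially[OF M(2)] y(1) m by blast
  have "(\<lambda>n. D + inverse (real (Suc n))) \<longlonglongrightarrow> D + 0"
    by (intro tendsto_intros LIMSEQ_inverse_real_of_nat)
  moreover have "(\<lambda>n. (norm (x - y n))\<^sup>2) \<longlonglongrightarrow> (norm (x - m))\<^sup>2"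
    by (intro tendsto_intros m)
  ultimately have m_le: "(norm (x - m))\<^sup>2 \<le> D"
    using LIMSEQ_le[of "\<lambda>n. (norm (x - y n))\<^sup>2" _ "\<lambda>n. D + inverse (real (Suc n))" "D + 0"]
      less_imp_le[OF y(2)] by auto
  have "(x - m) \<bullet> n = 0" if n: "n \<in> M" for n
  proof (cases "n = 0")
    case False
    \<comment> \<open>The value of \<open>t\<close> minimising the distance from \<open>x\<close> to
      \<open>m + t *\<^sub>R n\<close>; minimality of \<open>m\<close> then forces the square of
      \<open>(x - m) \<bullet> n\<close> to be at most 0.\<close>
    define t where "t = ((x - m) \<bullet> n) / (n \<bullet> n)"
    have "m + t *\<^sub>R n \<in> M"
      using M(1) \<open>m \<in> M\<close> n by (simp add: subspace_add subspace_scale)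
    then have "(norm (x - m))\<^sup>2 \<le> (norm (x - (m + t *\<^sub>R n)))\<^sup>2"
      using D_le m_le order_trans by blast
    also have "\<dots> = (norm (x - m))\<^sup>2 - 2 * t * ((x - m) \<bullet> n) + t * (t * (n \<bullet> n))"
      unfolding power2_norm_eq_inner
      by (simp add: inner_diff_left inner_diff_right inner_add_left inner_add_right inner_commute algebra_simps)
    also have "t * (n \<bullet> n) = (x - m) \<bullet> n"
      using False by (simp add: t_def)
    finally have "t * ((x - m) \<bullet> n) \<le> 0"
      by simp
    then have "((x - m) \<bullet> n) * ((x - m) \<bullet> n) \<le> 0"
      using False by (simp add: t_def field_simps)
    then show ?thesis
      by (metis mult_eq_0_iff order_antisym zero_le_square)
  qed simp
  with \<open>m \<in> M\<close> show thesis
    by (rule that)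
qed

lemma subspace_closure:
  fixes M :: "'a::real_normed_vector set"
  assumes "subspace M"
  shows "subspace (closure M)"
proof (rule subspaceI)
  show "0 \<in> closure M"
    using subspace_0[OF assms] closure_subset by blast
next
  fix x y assume "x \<in> closure M" "y \<in> closure M"
  then obtain a b where "\<And>n. a n \<in> M" "a \<longlonglongrightarrow> x" "\<And>n. b n \<in> M" "b \<longlonglongrightarrow> y"
    unfolding closure_sequential by blast
  then show "x + y \<in> closure M"
    unfolding closure_sequential using subspace_add[OF assms]
    by (intro exI[of _ "\<lambda>n. a n + b n"]) (auto intro: tendsto_add)
next
  fix c x assume "x \<in> closure M"
  then obtain a where "\<And>n. a n \<in> M" "a \<longlonglongrightarrow> x"
    unfolding closure_sequential by blast
  then show "c *\<^sub>R x \<in> closure M"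
    unfolding closure_sequential using subspace_scale[OF assms]
    by (intro exI[of _ "\<lambda>n. c *\<^sub>R a n"]) (auto intro: tendsto_intros)
qed

lemma closure_subspace_eq_UNIV:
  fixes M :: "'a::{real_inner,complete_space} set"
  assumes M: "subspace M" and perp: "\<And>x. (\<And>n. n \<in> M \<Longrightarrow> x \<bullet> n = 0) \<Longrightarrow> x = 0"
  shows "closure M = UNIV"
proof -
  have "x \<in> closure M" for x
  proof -
    obtain m where m: "m \<in> closure M" "\<And>n. n \<in> closure M \<Longrightarrow> (x - m) \<bullet> n = 0"
      using closed_subspace_decomposition[of "closure M" x] M by (metis closed_closure subspace_closure)
    then have "x - m = 0"
      using perp closure_subset by blast
    with m show ?thesis
      by simp
  qed
  then show ?thesis
    by blast
qed

text \<open>As a relation this is the orthogonal complement of the rotated graph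
  \<open>{(u, - x)}\<close>, hence a closed subspace for every \<open>T\<close>, even where it is
  not a function.\<close>

definition real_adjoint :: "('a::real_inner \<times> 'b::real_inner) set \<Rightarrow> ('b \<times> 'a) set" where
  "real_adjoint T = {(y, z). \<forall>(x, u) \<in> T. u \<bullet> y = x \<bullet> z}"

lemma real_adjointD: "(y, z) \<in> real_adjoint T \<Longrightarrow> (x, u) \<in> T \<Longrightarrow> u \<bullet> y = x \<bullet> z"
  by (auto simp: real_adjoint_def)

lemma subspace_real_adjoint: "subspace (real_adjoint T)"
  unfolding subspace_def real_adjoint_def zero_prod_def
  by (fastforce simp: inner_add_right)

lemma closed_real_adjoint: "closed (real_adjoint T)"
proof -
  have "real_adjoint T = (\<Inter>p\<in>T. {q. snd p \<bullet> fst q = fst p \<bullet> snd q})"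
    by (fastforce simp: real_adjoint_def)
  also have "closed \<dots>"
    by (intro closed_INT ballI closed_Collect_eq continuous_intros)
  finally show ?thesis .
qed

text \<open>If \<open>(x, u)\<close> is the projection of \<open>(h, 0)\<close> onto the graph, the
  residual \<open>(h - x, - u)\<close> is orthogonal to the graph, and this orthogonality is
  precisely membership of \<open>(u, h - x)\<close> in the adjoint.\<close>

lemma exists_one_plus_adjoint:
  fixes T :: "('a::{real_inner,complete_space} \<times> 'b::{real_inner,complete_space}) set"
  assumes "subspace T" "closed T"
  obtains x u where "(x, u) \<in> T" "(u, h - x) \<in> real_adjoint T"
proof -
  obtain m where m: "m \<in> T" "\<And>n. n \<in> T \<Longrightarrow> ((h, 0) - m) \<bullet> n = 0"
    using closed_subspace_decomposition[OF assms] by blast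
  have "(snd m, h - fst m) \<in> real_adjoint T"
    unfolding real_adjoint_def using m(2)
    by (force simp: inner_prod_def inner_commute)
  then show thesis
    using m(1) that[of "fst m" "snd m"] by simp
qed

lemma core_of_closed_operator:
  fixes T :: "('a::{real_inner,complete_space} \<times> 'b::{real_inner,complete_space}) set"
  assumes T: "subspace T" "closed T" "single_valued T"
  shows "closure {(x, u) \<in> T. x \<in> Domain (T O real_adjoint T)} = T" (is "closure ?M = T")
proof
  show "closure ?M \<subseteq> T"
    using T(2) by (intro closure_minimal) auto
next
  have add: "(x + y, u + v) \<in> T" if "(x, u) \<in> T" "(y, v) \<in> T" for x y u v
    using subspace_add[OF T(1) that] by simp
  have scale: "(c *\<^sub>R x, c *\<^sub>R u) \<in> T" if "(x, u) \<in> T" for x u c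
    using subspace_scale[OF T(1) that, of c] by simp
  have addA: "(x + y, u + v) \<in> real_adjoint T" if "(x, u) \<in> real_adjoint T" "(y, v) \<in> real_adjoint T" for x y u v
    using subspace_add[OF subspace_real_adjoint that] by simp
  have scaleA: "(c *\<^sub>R x, c *\<^sub>R u) \<in> real_adjoint T" if "(x, u) \<in> real_adjoint T" for x u c
    using subspace_scale[OF subspace_real_adjoint that, of c] by simp
  have z: "(0, 0) \<in> T" "(0, 0) \<in> real_adjoint T"
    using subspace_0[OF T(1)] subspace_0[OF subspace_real_adjoint] by (auto simp: zero_prod_def)
  have "subspace ?M"
  proof (rule subspaceI)
    show "0 \<in> ?M"
      using z by (auto simp: zero_prod_def)
  next
    fix p q assume "p \<in> ?M" "q \<in> ?M"
    then obtain x u w y v r where "p = (x, u)" "(x, u) \<in> T" "(x, w) \<in> T O real_adjoint T"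
      "q = (y, v)" "(y, v) \<in> T" "(y, r) \<in> T O real_adjoint T"
      by blast
    moreover from this have "(x + y, w + r) \<in> T O real_adjoint T"
      using add addA by blast
    ultimately show "p + q \<in> ?M"
      using add by auto
  next
    fix c p assume "p \<in> ?M"
    then obtain x u w where "p = (x, u)" "(x, u) \<in> T" "(x, w) \<in> T O real_adjoint T"
      by blast
    moreover from this have "(c *\<^sub>R x, c *\<^sub>R w) \<in> T O real_adjoint T"
      using scale scaleA by blast
    ultimately show "c *\<^sub>R p \<in> ?M"
      using scale by auto
  qed
  then have M: "subspace (closure ?M)" "closed (closure ?M)"
    by (auto simp: subspace_closure)
  show "T \<subseteq> closure ?M"
  proof
    fix p assume p: "p \<in> T"
    obtain m where m: "m \<in> closure ?M" "\<And>n. n \<in> closure ?M \<Longrightarrow> (p - m) \<bullet> n = 0"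
      using closed_subspace_decomposition[OF M] by blast
    have "m \<in> T"
      using m(1) T(2) closure_minimal[of ?M T] by auto
    then have "p - m \<in> T"
      using p T(1) by (simp add: subspace_diff)
    then obtain x u where xu: "p - m = (x, u)" "(x, u) \<in> T"
      by (metis surj_pair)
    \<comment> \<open>With \<open>a + T\<^sup>*T a = x\<close>, the pair \<open>(a, b)\<close> lies
      in \<open>?M\<close>, and its orthogonality to \<open>(x, u)\<close> in the graph inner
      product becomes \<open>x \<bullet> x = 0\<close>.\<close>
    obtain a b where ab: "(a, b) \<in> T" "(b, x - a) \<in> real_adjoint T"
      using exists_one_plus_adjoint[OF T(1,2)] by blast
    then have "(a, b) \<in> closure ?M"
      by (intro subsetD[OF closure_subset]) auto
    then have "x \<bullet> a + u \<bullet> b = 0"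
      using m(2) xu(1) by (force simp: inner_prod_def)
    moreover have "u \<bullet> b = x \<bullet> (x - a)"
      using real_adjointD[OF ab(2) xu(2)] .
    ultimately have "x = 0"
      by (simp add: inner_diff_right)
    with xu z T(3) have "p - m = 0"
      by (auto simp: single_valued_def zero_prod_def)
    with m(1) show "p \<in> closure ?M"
      by simp
  qed
qed

text \<open>The abstract content of the uniqueness of the polar decomposition: \<open>T\<^sup>*T\<close> determines the
  graph norm of \<open>T\<close> on a core.\<close>

lemma form_determines_operator_norm:
  fixes T :: "('a::{real_inner,complete_space} \<times> 'b::{real_inner,complete_space}) set"
    and R :: "('a \<times> 'c::{real_inner,complete_space}) set"
  assumes T: "subspace T" "closed T" "single_valued T"
    and R: "subspace R" "closed R" "single_valued R"
    and eq: "T O real_adjoint T = R O real_adjoint R"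
    and xu: "(x, u) \<in> T"
  shows "\<exists>v. (x, v) \<in> R \<and> norm v = norm u"
proof -
  obtain s where s: "\<And>n. s n \<in> T" "\<And>n. fst (s n) \<in> Domain (T O real_adjoint T)" "s \<longlonglongrightarrow> (x, u)"
  proof -
    have "(x, u) \<in> closure {(x, u) \<in> T. x \<in> Domain (T O real_adjoint T)}"
      using core_of_closed_operator[OF T] xu by simp
    then show thesis
      unfolding closure_sequential
      using that by (metis (no_types, lifting) case_prodE fst_conv mem_Collect_eq)
  qed
  have "\<exists>v. (fst (s n), v) \<in> R" for n
    using s(2)[of n] eq by blast
  then obtain r where r: "\<And>n. (fst (s n), r n) \<in> R"
    by metis
  \<comment> \<open>The common value \<open>w\<close> of the two compositions at \<open>x\<close>
    gives \<open>u \<bullet> u = x \<bullet> w = v \<bullet> v\<close>.\<close>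
  have norm_eq: "norm v = norm u" if x: "x \<in> Domain (T O real_adjoint T)" "(x, u) \<in> T" "(x, v) \<in> R" for x u v
  proof -
    obtain w where "(x, w) \<in> T O real_adjoint T" "(x, w) \<in> R O real_adjoint R"
      using x(1) eq by blast
    then have "(u, w) \<in> real_adjoint T" "(v, w) \<in> real_adjoint R"
      using x(2,3) T(3) R(3) by (metis relcompEpair single_valuedD)+
    then have "u \<bullet> u = x \<bullet> w" "v \<bullet> v = x \<bullet> w"
      using x by (auto dest: real_adjointD)
    then show ?thesis
      by (simp add: norm_eq_sqrt_inner)
  qed
  have DomD: "a - b \<in> Domain (T O real_adjoint T)"
    if ab: "a \<in> Domain (T O real_adjoint T)" "b \<in> Domain (T O real_adjoint T)" for a b
  proof -
    obtain c d e f where "(a, c) \<in> T" "(c, d) \<in> real_adjoint T" "(b, e) \<in> T" "(e, f) \<in> real_adjoint T"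
      using ab by blast
    then have "(a - b, c - e) \<in> T" "(c - e, d - f) \<in> real_adjoint T"
      using subspace_diff[OF T(1)] subspace_diff[OF subspace_real_adjoint] by force+
    then show ?thesis
      by blast
  qed
  \<comment> \<open>Applied to differences, the norm equality makes the \<open>R\<close>-values
    along \<open>s\<close> Cauchy because the \<open>T\<close>-values converge.\<close>
  have diff: "norm (r m - r n) = norm (snd (s m) - snd (s n))" for m n
  proof (rule norm_eq)
    show "fst (s m) - fst (s n) \<in> Domain (T O real_adjoint T)"
      using DomD s(2) by blast
    show "(fst (s m) - fst (s n), snd (s m) - snd (s n)) \<in> T"
      using subspace_diff[OF T(1) s(1) s(1), of m n] by (simp add: minus_prod_def)
    show "(fst (s m) - fst (s n), r m - r n) \<in> R"
      using subspace_diff[OF R(1) r r, of m n] by simp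
  qed
  have lim: "(\<lambda>n. fst (s n)) \<longlonglongrightarrow> x" "(\<lambda>n. snd (s n)) \<longlonglongrightarrow> u"
    using tendsto_fst[OF s(3)] tendsto_snd[OF s(3)] by auto
  have "Cauchy (\<lambda>n. snd (s n))"
    using lim(2) by (rule LIMSEQ_imp_Cauchy)
  then have "Cauchy r"
    unfolding Cauchy_def dist_norm diff .
  then obtain v where v: "r \<longlonglongrightarrow> v"
    using Cauchy_convergent convergent_def by blast
  have "(\<lambda>n. (fst (s n), r n)) \<longlonglongrightarrow> (x, v)"
    by (intro tendsto_intros lim v)
  then have "(x, v) \<in> R"
    by (rule closed_sequentially[OF R(2) r])
  moreover have "norm (r n) = norm (snd (s n))" for n
    using norm_eq[OF s(2) _ r] s(1)[of n] by simp
  then have "norm v = norm u"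
    using tendsto_norm[OF v] tendsto_norm[OF lim(2)] LIMSEQ_unique by auto
  ultimately show ?thesis
    by blast
qed

section \<open>Square roots of symmetric contractions\<close>

text \<open>The operator interval 0 \<le> A \<le> 1. In this form it is visibly stable under A
  \<mapsto> 1 - A, which lets \<open>B\<close> and \<open>1 - B\<close> be treated alike; the norm
  bound is a consequence.\<close>

definition sym_contr :: "('a::real_inner \<Rightarrow> 'a) \<Rightarrow> bool" where
  "sym_contr A \<longleftrightarrow> linear A \<and> (\<forall>x y. A x \<bullet> y = x \<bullet> A y) \<and> (\<forall>x. 0 \<le> A x \<bullet> x \<and> A x \<bullet> x \<le> x \<bullet> x)"

lemma sym_contrD:
  assumes "sym_contr A"
  shows "linear A" "A x \<bullet> y = x \<bullet> A y" "0 \<le> A x \<bullet> x" "A x \<bullet> x \<le> x \<bullet> x"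
  using assms by (auto simp: sym_contr_def)

lemma sym_contr_compl:
  assumes "sym_contr A"
  shows "sym_contr (\<lambda>x. x - A x)"
  using assms unfolding sym_contr_def
  by (auto simp: inner_diff_left inner_diff_right intro!: linear_compose_sub linear_ident)

text \<open>Positivity of \<open>A\<close> at \<open>(1 - A) x\<close> says
  \<open>A - 2 A\<^sup>2 + A\<^sup>3 \<ge> 0\<close>, and \<open>A\<^sup>3 \<le> A\<^sup>2\<close>
  is \<open>A \<le> 1\<close> at the vector \<open>A x\<close>.\<close>

lemma sym_contr_inner_le:
  assumes "sym_contr A"
  shows "A x \<bullet> A x \<le> A x \<bullet> x"
proof -
  note A = sym_contrD[OF assms]
  have "0 \<le> A (x - A x) \<bullet> (x - A x)"
    by (rule A)
  also have "\<dots> = A x \<bullet> x - 2 * (A x \<bullet> A x) + A (A x) \<bullet> A x"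
    using A(2)[of "A x" x] by (simp add: linear_diff[OF A(1)] inner_diff_left inner_diff_right)
  finally show ?thesis
    using A(4)[of "A x"] by linarith
qed

lemma sym_contr_norm_le:
  assumes "sym_contr A"
  shows "norm (A x) \<le> norm x"
  using sym_contr_inner_le[OF assms, of x] sym_contrD(4)[OF assms, of x]
  by (simp add: norm_eq_sqrt_inner)

lemma sym_contr_bounded_linear:
  assumes "sym_contr A"
  shows "bounded_linear A"
  using sym_contrD(1)[OF assms] sym_contr_norm_le[OF assms]
  by (intro bounded_linear_intro[where K = 1]) (auto simp: linear_add linear_scale)

text \<open>For \<open>X = 1 - A\<close>, a fixed point \<open>Y\<close> of \<open>Y \<mapsto> (X + Y\<^sup>2) / 2\<close> satisfies \<open>(1 - Y)\<^sup>2 = A\<close>.\<close>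

primrec sqrt_scalar :: "nat \<Rightarrow> real" where
  "sqrt_scalar 0 = 0"
| "sqrt_scalar (Suc n) = (1 + (sqrt_scalar n)\<^sup>2) / 2"

primrec sqrt_iter :: "('a::real_inner \<Rightarrow> 'a) \<Rightarrow> nat \<Rightarrow> 'a \<Rightarrow> 'a" where
  "sqrt_iter X 0 x = 0"
| "sqrt_iter X (Suc n) x = (1/2) *\<^sub>R (X x + sqrt_iter X n (sqrt_iter X n x))"

lemma sqrt_scalar_bounds: "0 \<le> sqrt_scalar n \<and> sqrt_scalar n \<le> 1"
proof (induction n)
  case (Suc n)
  then have "(sqrt_scalar n)\<^sup>2 \<le> 1"
    by (simp add: power_le_one)
  then show ?case
    by simp
qed simp

lemma incseq_sqrt_scalar: "incseq sqrt_scalar"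
proof (rule incseq_SucI)
  show "sqrt_scalar n \<le> sqrt_scalar (Suc n)" for n
    using zero_le_power2[of "sqrt_scalar n - 1"] by (simp add: power2_eq_square algebra_simps)
qed

text \<open>The scalar sequence dominates the operator iteration, so this is the only source of
  convergence there; the value of the limit never enters.\<close>

lemma Cauchy_sqrt_scalar: "Cauchy sqrt_scalar"
  using incseq_convergent[OF incseq_sqrt_scalar] sqrt_scalar_bounds LIMSEQ_imp_Cauchy by metis

text \<open>The iterates are polynomials in \<open>X\<close>. The lemma is applied with
  \<open>T\<close> equal to \<open>X\<close>, to another iterate, and to any bounded operator
  commuting with \<open>A\<close>.\<close>

lemma sqrt_iter_commute:
  assumes "linear T" and "\<And>x. T (X x) = X (T x)"
  shows "T (sqrt_iter X n x) = sqrt_iter X n (T x)"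
  by (induction n arbitrary: x)
    (simp_all add: linear_0[OF assms(1)] linear_add[OF assms(1)] linear_scale[OF assms(1)] assms(2))

lemma linear_sqrt_iter:
  assumes "linear X"
  shows "linear (sqrt_iter X n)"
proof (induction n)
  case 0
  then show ?case
    by (intro linearI) auto
next
  case (Suc n)
  then show ?case
    by (intro linearI) (auto simp: linear_add linear_scale assms algebra_simps)
qed

context
  fixes A X :: "'a::{real_inner,complete_space} \<Rightarrow> 'a"
  assumes A: "sym_contr A"
  defines "X \<equiv> \<lambda>x. x - A x"
begin

private lemma X: "sym_contr X"
  unfolding X_def by (rule sym_contr_compl[OF A])

private lemmas linX = sym_contrD(1)[OF X]

private lemma iter_X: "X (sqrt_iter X n x) = sqrt_iter X n (X x)"
  by (rule sqrt_iter_commute[OF linX]) simp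

private lemma iter_iter: "sqrt_iter X m (sqrt_iter X n x) = sqrt_iter X n (sqrt_iter X m x)"
  by (rule sqrt_iter_commute[OF linear_sqrt_iter[OF linX]]) (simp add: iter_X)

private lemma iter_symmetric: "sqrt_iter X n x \<bullet> y = x \<bullet> sqrt_iter X n y"
  by (induction n arbitrary: x y)
    (simp_all add: inner_add_left inner_add_right sym_contrD(2)[OF X])

private lemma iter_norm: "norm (sqrt_iter X n x) \<le> sqrt_scalar n * norm x"
proof (induction n arbitrary: x)
  case (Suc n)
  have "norm (sqrt_iter X n (sqrt_iter X n x)) \<le> sqrt_scalar n * norm (sqrt_iter X n x)"
    by (rule Suc)
  also have "\<dots> \<le> sqrt_scalar n * (sqrt_scalar n * norm x)"
    by (intro mult_left_mono Suc) (simp add: sqrt_scalar_bounds)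
  finally have "norm (X x + sqrt_iter X n (sqrt_iter X n x)) \<le> (1 + (sqrt_scalar n)\<^sup>2) * norm x"
    using sym_contr_norm_le[OF X, of x]
    by (intro norm_triangle_le) (simp add: power2_eq_square algebra_simps)
  then show ?case
    by (simp del: scaleR_right_distrib)
qed simp

text \<open>Both increments are the same polynomial with nonnegative coefficients, evaluated at the
  contraction \<open>X\<close> and at \<open>1\<close>.\<close>

private lemma iter_step:
  "norm (sqrt_iter X (Suc n) x - sqrt_iter X n x) \<le> (sqrt_scalar (Suc n) - sqrt_scalar n) * norm x"
proof (induction n arbitrary: x)
  case 0
  then show ?case
    using sym_contr_norm_le[OF X, of x] by simp
next
  case (Suc n)
  let ?Y = "sqrt_iter X (Suc n)" and ?Z = "sqrt_iter X n"
  let ?y = "sqrt_scalar (Suc n)" and ?z = "sqrt_scalar n"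
  define d where "d = ?Y x - ?Z x"
  have lin: "linear ?Y" "linear ?Z"
    by (rule linear_sqrt_iter[OF linX])+
  have d: "norm d \<le> (?y - ?z) * norm x"
    unfolding d_def by (rule Suc)
  \<comment> \<open>Since the iterates commute, the difference of squares factors as
    \<open>(Y + Z)(Y - Z)\<close>; the scalar increments factor in the same way.\<close>
  have "?Y (?Y x) - ?Z (?Z x) = ?Y d + ?Z d"
    unfolding d_def linear_diff[OF lin(1)] linear_diff[OF lin(2)] iter_iter[of n "Suc n"] by simp
  then have "norm (?Y (?Y x) - ?Z (?Z x)) \<le> ?y * norm d + ?z * norm d"
    using norm_triangle_le add_mono[OF iter_norm iter_norm] by metis
  also have "\<dots> = (?y + ?z) * norm d"
    by (simp add: algebra_simps)
  also have "\<dots> \<le> (?y + ?z) * ((?y - ?z) * norm x)"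
    by (intro mult_left_mono d add_nonneg_nonneg) (simp_all only: sqrt_scalar_bounds)
  also have "\<dots> = 2 * (sqrt_scalar (Suc (Suc n)) - ?y) * norm x"
    unfolding sqrt_scalar.simps(2)[of "Suc n"] sqrt_scalar.simps(2)[of n]
    by (simp add: power2_eq_square field_simps)
  finally have "norm (?Y (?Y x) - ?Z (?Z x)) \<le> 2 * (sqrt_scalar (Suc (Suc n)) - ?y) * norm x" .
  moreover have "sqrt_iter X (Suc (Suc n)) x - ?Y x = (1/2) *\<^sub>R (?Y (?Y x) - ?Z (?Z x))"
    unfolding sqrt_iter.simps(2)[of X "Suc n"] sqrt_iter.simps(2)[of X n x]
    by (simp add: scaleR_right_diff_distrib scaleR_right_distrib)
  ultimately show ?case
    by (simp del: sqrt_iter.simps sqrt_scalar.simps add: left_diff_distrib)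
qed

private lemma iter_diff:
  assumes "m \<le> n"
  shows "norm (sqrt_iter X n x - sqrt_iter X m x) \<le> (sqrt_scalar n - sqrt_scalar m) * norm x"
  using assms
proof (induction n rule: dec_induct)
  case (step n)
  have "norm (sqrt_iter X (Suc n) x - sqrt_iter X m x)
      \<le> norm (sqrt_iter X (Suc n) x - sqrt_iter X n x) + norm (sqrt_iter X n x - sqrt_iter X m x)"
    using norm_triangle_ineq[of "sqrt_iter X (Suc n) x - sqrt_iter X n x" "sqrt_iter X n x - sqrt_iter X m x"]
    by (simp del: sqrt_iter.simps)
  then show ?case
    using iter_step[of n x] step.IH unfolding left_diff_distrib by linarith
qed simp

private lemma iter_Cauchy: "Cauchy (\<lambda>n. sqrt_iter X n x)"
proof (rule metric_CauchyI)
  fix e :: real assume "e > 0"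
  then obtain N where N: "\<And>m n. m \<ge> N \<Longrightarrow> n \<ge> N \<Longrightarrow> dist (sqrt_scalar m) (sqrt_scalar n) < e / (norm x + 1)"
    using metric_CauchyD[OF Cauchy_sqrt_scalar, of "e / (norm x + 1)"]
    by (metis add_nonneg_pos divide_pos_pos norm_ge_zero zero_less_one)
  have le: "dist (sqrt_iter X n x) (sqrt_iter X m x) < e" if "N \<le> m" "m \<le> n" for m n
  proof -
    have "dist (sqrt_iter X n x) (sqrt_iter X m x) \<le> (sqrt_scalar n - sqrt_scalar m) * norm x"
      unfolding dist_norm by (rule iter_diff[OF that(2)])
    also have "\<dots> \<le> (sqrt_scalar n - sqrt_scalar m) * (norm x + 1)"
      using incseqD[OF incseq_sqrt_scalar that(2)] by (intro mult_left_mono) auto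
    also have "\<dots> < e"
      using N[of n m] that incseqD[OF incseq_sqrt_scalar that(2)]
      by (simp add: dist_real_def pos_less_divide_eq add_nonneg_pos)
    finally show ?thesis .
  qed
  then show "\<exists>N. \<forall>m\<ge>N. \<forall>n\<ge>N. dist (sqrt_iter X m x) (sqrt_iter X n x) < e"
    by (metis dist_commute linorder_linear)
qed

text \<open>The root is \<open>1 - Y\<close> with \<open>Y\<close> the pointwise limit of the
  iterates. The commutation clause later yields uniqueness of the root, commutation of the roots of
  \<open>B\<close> and \<open>1 - B\<close>, and compatibility with complex scalars.\<close>

lemma sym_contr_sqrt:
  "\<exists>P. sym_contr P \<and> (\<forall>x. P (P x) = A x)
    \<and> (\<forall>T. bounded_linear T \<longrightarrow> (\<forall>x. T (A x) = A (T x)) \<longrightarrow> (\<forall>x. T (P x) = P (T x)))"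
proof -
  define Y where "Y x = lim (\<lambda>n. sqrt_iter X n x)" for x
  have lim: "(\<lambda>n. sqrt_iter X n x) \<longlonglongrightarrow> Y x" for x
    unfolding Y_def using iter_Cauchy Cauchy_convergent convergent_LIMSEQ_iff by blast
  have linY: "linear Y"
  proof (rule linearI)
    fix x y :: 'a and c :: real
    have "(\<lambda>n. sqrt_iter X n (x + y)) \<longlonglongrightarrow> Y x + Y y"
      unfolding linear_add[OF linear_sqrt_iter[OF linX]] by (intro tendsto_intros lim)
    then show "Y (x + y) = Y x + Y y"
      using lim LIMSEQ_unique by blast
    have "(\<lambda>n. sqrt_iter X n (c *\<^sub>R x)) \<longlonglongrightarrow> c *\<^sub>R Y x"
      unfolding linear_scale[OF linear_sqrt_iter[OF linX]] by (intro tendsto_intros lim)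
    then show "Y (c *\<^sub>R x) = c *\<^sub>R Y x"
      using lim LIMSEQ_unique by blast
  qed
  have normY: "norm (Y x) \<le> norm x" for x
  proof (rule LIMSEQ_le_const2[OF tendsto_norm[OF lim]])
    have "norm (sqrt_iter X n x) \<le> norm x" for n
      using iter_norm[of n x] mult_right_mono[of "sqrt_scalar n" 1 "norm x"] sqrt_scalar_bounds[of n]
      by simp
    then show "\<exists>N. \<forall>n\<ge>N. norm (sqrt_iter X n x) \<le> norm x"
      by blast
  qed
  have symY: "Y x \<bullet> y = x \<bullet> Y y" for x y
  proof -
    have "(\<lambda>n. sqrt_iter X n x \<bullet> y) \<longlonglongrightarrow> Y x \<bullet> y" "(\<lambda>n. x \<bullet> sqrt_iter X n y) \<longlonglongrightarrow> x \<bullet> Y y"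
      by (intro tendsto_intros lim)+
    then show ?thesis
      unfolding iter_symmetric by (rule LIMSEQ_unique)
  qed
  have comm: "T (Y x) = Y (T x)" if T: "bounded_linear T" and TA: "\<And>x. T (A x) = A (T x)" for T x
  proof -
    have "linear T"
      using T by (rule bounded_linear.linear)
    then have "T (sqrt_iter X n x) = sqrt_iter X n (T x)" for n
      by (intro sqrt_iter_commute) (auto simp: X_def TA linear_diff)
    then have "(\<lambda>n. sqrt_iter X n (T x)) \<longlonglongrightarrow> T (Y x)"
      using bounded_linear.tendsto[OF T lim[of x]] by simp
    then show ?thesis
      using lim LIMSEQ_unique by blast
  qed
  have YY: "X x + Y (Y x) = 2 *\<^sub>R Y x" for x
  proof -
    \<comment> \<open>A product of pointwise convergent operators: the iterates have norm at most 1,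
      which controls the error of the inner factor, and pointwise convergence at \<open>Y x\<close>
      controls the outer one.\<close>
    have "(\<lambda>n. sqrt_iter X n (sqrt_iter X n x) - Y (Y x)) \<longlonglongrightarrow> 0"
    proof (rule Lim_null_comparison)
      show "\<forall>\<^sub>F n in sequentially. norm (sqrt_iter X n (sqrt_iter X n x) - Y (Y x))
          \<le> norm (sqrt_iter X n x - Y x) + norm (sqrt_iter X n (Y x) - Y (Y x))"
      proof (rule always_eventually, rule allI)
        fix n
        have "norm (sqrt_iter X n (sqrt_iter X n x - Y x)) \<le> norm (sqrt_iter X n x - Y x)"
          using iter_norm[of n "sqrt_iter X n x - Y x"] sqrt_scalar_bounds[of n]
            mult_right_mono[of "sqrt_scalar n" 1 "norm (sqrt_iter X n x - Y x)"] by simp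
        then show "norm (sqrt_iter X n (sqrt_iter X n x) - Y (Y x))
            \<le> norm (sqrt_iter X n x - Y x) + norm (sqrt_iter X n (Y x) - Y (Y x))"
          unfolding linear_diff[OF linear_sqrt_iter[OF linX]]
          using norm_triangle_ineq[of "sqrt_iter X n (sqrt_iter X n x) - sqrt_iter X n (Y x)"
              "sqrt_iter X n (Y x) - Y (Y x)"]
          by simp
      qed
      have "(\<lambda>n. norm (sqrt_iter X n z - Y z)) \<longlonglongrightarrow> 0" for z
        using lim by (simp add: LIM_zero tendsto_norm_zero)
      from tendsto_add[OF this this]
      show "(\<lambda>n. norm (sqrt_iter X n x - Y x) + norm (sqrt_iter X n (Y x) - Y (Y x))) \<longlonglongrightarrow> 0"
        by simp
    qed
    then have "(\<lambda>n. sqrt_iter X n (sqrt_iter X n x)) \<longlonglongrightarrow> Y (Y x)"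
      by (rule LIM_zero_cancel)
    then have "(\<lambda>n. sqrt_iter X (Suc n) x) \<longlonglongrightarrow> (1/2) *\<^sub>R (X x + Y (Y x))"
      by (simp del: scaleR_right_distrib) (intro tendsto_intros)
    moreover have "(\<lambda>n. sqrt_iter X (Suc n) x) \<longlonglongrightarrow> Y x"
      using lim by (rule LIMSEQ_Suc)
    ultimately have "Y x = (1/2) *\<^sub>R (X x + Y (Y x))"
      using LIMSEQ_unique by blast
    then have "2 *\<^sub>R Y x = 2 *\<^sub>R ((1/2) *\<^sub>R (X x + Y (Y x)))"
      by (rule arg_cong)
    then show ?thesis
      by simp
  qed
  define P where "P x = x - Y x" for x
  have symP: "P x \<bullet> y = x \<bullet> P y" for x y
    by (simp add: P_def inner_diff_left inner_diff_right symY)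
  have PP: "P (P x) = A x" for x
    using YY[of x] by (simp add: P_def X_def linear_diff[OF linY] scaleR_2 algebra_simps)
  \<comment> \<open>The two form bounds have different sources: P \<le> 1 comes from
    \<open>P x \<bullet> P x = A x \<bullet> x\<close>, while P \<ge> 0 comes from
    \<open>norm (Y x) \<le> norm x\<close>.\<close>
  have "P x \<bullet> P x \<le> x \<bullet> x" for x
    using sym_contrD(4)[OF A, of x] symP[of "P x" x] by (simp add: PP)
  then have normP: "norm (P x) \<le> norm x" for x
    by (simp add: norm_eq_sqrt_inner)
  have le: "T x \<bullet> x \<le> x \<bullet> x" if "norm (T x) \<le> norm x" for T :: "'a \<Rightarrow> 'a" and x
    using norm_cauchy_schwarz[of "T x" x] mult_right_mono[OF that, of "norm x"]
    by (simp flip: power2_norm_eq_inner power2_eq_square)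
  have "linear P"
    unfolding P_def by (intro linear_compose_sub linear_ident linY)
  moreover have "0 \<le> P x \<bullet> x" for x
    using le[of Y, OF normY] by (simp add: P_def inner_diff_left)
  ultimately have "sym_contr P"
    using symP le[of P, OF normP] by (auto simp: sym_contr_def)
  moreover have "T (P x) = P (T x)" if "bounded_linear T" "\<And>x. T (A x) = A (T x)" for T x
    using comm[OF that] linear_diff[OF bounded_linear.linear[OF that(1)]] by (simp add: P_def)
  ultimately show ?thesis
    using PP by blast
qed

end

text \<open>For \<open>y = (P - Q) x\<close> commutation gives
  \<open>(P + Q) y = (P\<^sup>2 - Q\<^sup>2) x = 0\<close>. Positivity then forces
  \<open>P y = Q y = 0\<close>, and symmetry turns \<open>y \<bullet> y\<close> into
  \<open>x \<bullet> (P - Q) y = 0\<close>.\<close>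

lemma sym_contr_eq_if_squares_eq:
  assumes P: "sym_contr P" and Q: "sym_contr Q"
    and comm: "\<And>x. P (Q x) = Q (P x)" and sq: "\<And>x. P (P x) = Q (Q x)"
  shows "P = Q"
proof
  fix x
  note lin = linear_diff[OF sym_contrD(1)[OF P]] linear_diff[OF sym_contrD(1)[OF Q]]
  define y where "y = P x - Q x"
  have "P y + Q y = 0"
    by (simp add: y_def lin comm sq)
  then have "P y \<bullet> y + Q y \<bullet> y = 0"
    by (metis inner_add_left inner_zero_left)
  then have "P y \<bullet> y = 0" "Q y \<bullet> y = 0"
    using sym_contrD(3)[OF P, of y] sym_contrD(3)[OF Q, of y] by linarith+
  then have "P y = 0" "Q y = 0"
    using sym_contr_inner_le[OF P, of y] sym_contr_inner_le[OF Q, of y]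
    by (metis inner_eq_zero_iff inner_ge_zero order_antisym)+
  moreover have "y \<bullet> y = x \<bullet> P y - x \<bullet> Q y"
    using sym_contrD(2)[OF P, of x y] sym_contrD(2)[OF Q, of x y] by (simp add: y_def inner_diff_left)
  ultimately have "y = 0"
    by simp
  then show "P x = Q x"
    by (simp add: y_def)
qed

text \<open>\<open>P\<close> and \<open>Q\<close> are not known to commute with each other, but each
  commutes with the common square and hence with the root \<open>Z\<close> constructed from it; both
  are therefore equal to \<open>Z\<close>.\<close>

lemma sym_contr_square_inj:
  fixes P Q :: "'a::{real_inner,complete_space} \<Rightarrow> 'a"
  assumes P: "sym_contr P" and Q: "sym_contr Q" and sq: "\<And>x. P (P x) = Q (Q x)"
  shows "P = Q"
proof -
  define A where "A x = P (P x)" for x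
  note lin = sym_contrD(1)[OF P]
  have "linear A"
    unfolding A_def by (intro linearI) (simp_all add: linear_add[OF lin] linear_scale[OF lin])
  moreover have "A x \<bullet> y = P x \<bullet> P y" "x \<bullet> A y = P x \<bullet> P y" for x y
    using sym_contrD(2)[OF P] by (simp_all add: A_def)
  moreover have "P x \<bullet> P x \<le> x \<bullet> x" for x
    using sym_contr_inner_le[OF P] sym_contrD(4)[OF P] order_trans by blast
  ultimately have "sym_contr A"
    by (simp add: sym_contr_def)
  then obtain Z where Z: "sym_contr Z" "\<And>x. Z (Z x) = A x"
    and comm: "\<And>T x. bounded_linear T \<Longrightarrow> (\<And>x. T (A x) = A (T x)) \<Longrightarrow> T (Z x) = Z (T x)"
    using sym_contr_sqrt[of A] by blast
  have "P = Z"
    using comm[OF sym_contr_bounded_linear[OF P]]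
    by (intro sym_contr_eq_if_squares_eq P Z(1)) (simp_all add: Z(2) A_def)
  moreover have "Q = Z"
    using comm[OF sym_contr_bounded_linear[OF Q]]
    by (intro sym_contr_eq_if_squares_eq Q Z(1)) (simp_all add: Z(2) A_def sq)
  ultimately show ?thesis
    by simp
qed

section \<open>Square roots of positive selfadjoint operators\<close>

text \<open>Linearity and closedness follow from \<open>real_adjoint H = H\<close>.
  Single-valuedness does not, and appears as a separate assumption where values are
  compared.\<close>

definition pos_selfadjoint :: "('a::real_inner \<times> 'a) set \<Rightarrow> bool" where
  "pos_selfadjoint H \<longleftrightarrow> real_adjoint H = H \<and> (\<forall>(x, u) \<in> H. 0 \<le> u \<bullet> x)"

lemma pos_selfadjointD:
  assumes "pos_selfadjoint H"
  shows "subspace H" "closed H" "(x, u) \<in> H \<Longrightarrow> (y, v) \<in> H \<Longrightarrow> u \<bullet> y = x \<bullet> v"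
    "(x, u) \<in> H \<Longrightarrow> 0 \<le> u \<bullet> x"
    "(x, u) \<in> H \<Longrightarrow> (y, v) \<in> H \<Longrightarrow> (x + y, u + v) \<in> H"
    "(x, u) \<in> H \<Longrightarrow> (y, v) \<in> H \<Longrightarrow> (x - y, u - v) \<in> H"
    "(x, u) \<in> H \<Longrightarrow> (c *\<^sub>R x, c *\<^sub>R u) \<in> H"
proof -
  have H: "real_adjoint H = H" and pos: "\<And>x u. (x, u) \<in> H \<Longrightarrow> 0 \<le> u \<bullet> x"
    using assms by (auto simp: pos_selfadjoint_def)
  show sub: "subspace H" and "closed H"
    using subspace_real_adjoint[of H] closed_real_adjoint[of H] by (simp_all add: H)
  show "(x, u) \<in> H \<Longrightarrow> (y, v) \<in> H \<Longrightarrow> u \<bullet> y = x \<bullet> v"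
    using real_adjointD[of y v H x u] by (simp add: H)
  show "(x, u) \<in> H \<Longrightarrow> 0 \<le> u \<bullet> x"
    by (rule pos)
  show "(x, u) \<in> H \<Longrightarrow> (y, v) \<in> H \<Longrightarrow> (x + y, u + v) \<in> H"
    "(x, u) \<in> H \<Longrightarrow> (y, v) \<in> H \<Longrightarrow> (x - y, u - v) \<in> H"
    "(x, u) \<in> H \<Longrightarrow> (c *\<^sub>R x, c *\<^sub>R u) \<in> H"
    using subspace_add[OF sub, of "(x, u)" "(y, v)"] subspace_diff[OF sub, of "(x, u)" "(y, v)"]
      subspace_scale[OF sub, of "(x, u)" c] by simp_all
qed

text \<open>\<open>H\<close> is not yet known to be of the form \<open>T\<^sup>*T\<close>. Instead,
  \<open>1 + H\<close> does not shrink norms, so its range is closed, and a vector \<open>x\<close>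
  orthogonal to the range satisfies \<open>(x, - x) \<in> H\<close>, which positivity allows only
  for \<open>x = 0\<close>.\<close>

lemma resolvent_exists:
  fixes H :: "('a::{real_inner,complete_space} \<times> 'a) set"
  assumes H: "pos_selfadjoint H"
  shows "\<exists>x. (x, h - x) \<in> H"
proof -
  note HD = pos_selfadjointD[OF H]
  define M where "M = (\<lambda>(x, u). x + u) ` H"
  have "linear (\<lambda>(x, u). x + u :: 'a)"
    by (intro linearI) (auto simp: scaleR_right_distrib)
  then have "subspace M"
    unfolding M_def by (intro linear_subspace_image HD)
  have "closed M"
    unfolding closed_sequential_limits
  proof (intro allI impI, elim conjE)
    fix s l assume s: "\<forall>n. s n \<in> M" and l: "s \<longlonglongrightarrow> l"
    have "\<exists>x. (x, s n - x) \<in> H" for n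
    proof -
      obtain x u where "(x, u) \<in> H" "s n = x + u"
        using s unfolding M_def by (metis (no_types, lifting) case_prod_conv imageE surj_pair)
      then show ?thesis
        by (intro exI[of _ x]) simp
    qed
    then obtain x where x: "\<And>n. (x n, s n - x n) \<in> H"
      by metis
    have le: "dist (x m) (x n) \<le> dist (s m) (s n)" for m n
    proof -
      define d e where "d = x m - x n" and "e = s m - s n"
      have "(d, e - d) \<in> H"
        using HD(6)[OF x[of m] x[of n]] by (simp add: d_def e_def algebra_simps)
      then have "d \<bullet> d \<le> e \<bullet> d"
        using HD(4) by (force simp: inner_diff_left)
      also have "\<dots> \<le> norm e * norm d"
        by (rule norm_cauchy_schwarz)
      finally have "norm d * norm d \<le> norm e * norm d"
        by (simp flip: power2_norm_eq_inner power2_eq_square)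
      then have "norm d \<le> norm e"
        by (cases "d = 0") auto
      then show ?thesis
        by (simp add: d_def e_def dist_norm)
    qed
    have "Cauchy s"
      using l by (rule LIMSEQ_imp_Cauchy)
    then have "Cauchy x"
      unfolding Cauchy_def using le by (meson order_le_less_trans)
    then obtain y where y: "x \<longlonglongrightarrow> y"
      using Cauchy_convergent convergent_def by blast
    have "(\<lambda>n. (x n, s n - x n)) \<longlonglongrightarrow> (y, l - y)"
      by (intro tendsto_intros l y)
    then have "(y, l - y) \<in> H"
      by (rule closed_sequentially[OF HD(2) x])
    then show "l \<in> M"
      by (force simp: M_def)
  qed
  have "x = 0" if x: "\<And>n. n \<in> M \<Longrightarrow> x \<bullet> n = 0" for x
  proof -
    have "x \<bullet> (y + u) = 0" if "(y, u) \<in> H" for y u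
      using x that by (force simp: M_def)
    then have "(x, - x) \<in> real_adjoint H"
      unfolding real_adjoint_def by (auto simp: inner_commute inner_add_right add_eq_0_iff)
    then have "(x, - x) \<in> H"
      using H by (simp add: pos_selfadjoint_def)
    then have "x \<bullet> x \<le> 0"
      using HD(4) by fastforce
    then show "x = 0"
      by (metis inner_eq_zero_iff inner_ge_zero order_antisym)
  qed
  then have "closure M = UNIV"
    using closure_subspace_eq_UNIV[OF \<open>subspace M\<close>] by blast
  then have "h \<in> M"
    using \<open>closed M\<close> by simp
  then obtain x u where "(x, u) \<in> H" "h = x + u"
    unfolding M_def by (metis (no_types, lifting) case_prod_conv imageE surj_pair)
  then show ?thesis
    by (intro exI[of _ x]) simp
qed

lemma resolvent_unique:
  assumes H: "pos_selfadjoint H" and "(x, h - x) \<in> H" "(y, h - y) \<in> H"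
  shows "x = y"
proof -
  have "(x - y, - (x - y)) \<in> H"
    using pos_selfadjointD(6)[OF assms] by simp
  then have "(x - y) \<bullet> (x - y) \<le> 0"
    using pos_selfadjointD(4)[OF H, of "x - y" "- (x - y)"] unfolding inner_minus_left by simp
  then show ?thesis
    by (metis inner_eq_zero_iff inner_ge_zero order_antisym eq_iff_diff_eq_0)
qed

lemma resolvent:
  fixes H :: "('a::{real_inner,complete_space} \<times> 'a) set"
  assumes H: "pos_selfadjoint H"
  obtains B where "sym_contr B" "\<And>h. (B h, h - B h) \<in> H" "\<And>x u. (x, u) \<in> H \<Longrightarrow> B (x + u) = x"
proof -
  note HD = pos_selfadjointD[OF H]
  obtain B where B: "\<And>h. (B h, h - B h) \<in> H"
    using resolvent_exists[OF H] by metis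
  have eq: "B h = x" if "(x, h - x) \<in> H" for x h
    using resolvent_unique[OF H B that] .
  have "linear B"
  proof (rule linearI)
    show "B (x + y) = B x + B y" for x y
      using HD(5)[OF B[of x] B[of y]] by (intro eq) (simp add: algebra_simps)
    show "B (c *\<^sub>R x) = c *\<^sub>R B x" for c x
      using HD(7)[OF B[of x], of c] by (intro eq) (simp add: algebra_simps)
  qed
  moreover have "B x \<bullet> y = x \<bullet> B y" for x y
    using HD(3)[OF B[of x] B[of y]] by (simp add: inner_diff_left inner_diff_right)
  moreover have "0 \<le> B x \<bullet> x \<and> B x \<bullet> x \<le> x \<bullet> x" for x
  proof -
    have "0 \<le> (x - B x) \<bullet> B x"
      by (rule HD(4)[OF B])
    moreover have "B x \<bullet> x = (x - B x) \<bullet> B x + B x \<bullet> B x"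
      by (simp add: inner_diff_left inner_diff_right inner_commute)
    moreover have "x \<bullet> x - B x \<bullet> x = (x - B x) \<bullet> B x + (x - B x) \<bullet> (x - B x)"
      by (simp add: inner_diff_left inner_diff_right inner_commute)
    ultimately show ?thesis
      using inner_ge_zero[of "B x"] inner_ge_zero[of "x - B x"] by linarith
  qed
  ultimately have "sym_contr B"
    by (simp add: sym_contr_def)
  then show thesis
    using that B eq by simp
qed

text \<open>With \<open>B = (1 + H)\<^sup>-\<^sup>1\<close>, the graph of \<open>H\<close> is \<open>{(B h, (1 - B) h)}\<close>; the square root has the
  graph \<open>{(B\<^sup>1\<^sup>/\<^sup>2 h, (1 - B)\<^sup>1\<^sup>/\<^sup>2 h)}\<close>.\<close>

lemma pos_selfadjoint_sqrt:
  fixes H :: "('a::{real_inner,complete_space} \<times> 'a) set"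
  assumes H: "pos_selfadjoint H"
  obtains S where "pos_selfadjoint S" "S O S = H"
    "\<And>T x u. bounded_linear T \<Longrightarrow> (\<And>x u. (x, u) \<in> H \<Longrightarrow> (T x, T u) \<in> H)
      \<Longrightarrow> (x, u) \<in> S \<Longrightarrow> (T x, T u) \<in> S"
proof -
  obtain B where B: "sym_contr B" "\<And>h. (B h, h - B h) \<in> H" "\<And>x u. (x, u) \<in> H \<Longrightarrow> B (x + u) = x"
    using resolvent[OF H] by blast
  obtain P where P: "sym_contr P" "\<And>x. P (P x) = B x"
    and P_comm: "\<And>T x. bounded_linear T \<Longrightarrow> (\<And>x. T (B x) = B (T x)) \<Longrightarrow> T (P x) = P (T x)"
    using sym_contr_sqrt[OF B(1)] by blast
  obtain Q where Q: "sym_contr Q" "\<And>x. Q (Q x) = x - B x"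
    and Q_comm: "\<And>T x. bounded_linear T \<Longrightarrow> (\<And>x. T (x - B x) = T x - B (T x)) \<Longrightarrow> T (Q x) = Q (T x)"
    using sym_contr_sqrt[OF sym_contr_compl[OF B(1)]] by blast
  \<comment> \<open>A root of \<open>Q\<close> serves only to show positivity:
    \<open>Q x \<bullet> P x = Z x \<bullet> P (Z x)\<close>, because \<open>P\<close> commutes with
    \<open>Z\<close>.\<close>
  obtain Z where Z: "sym_contr Z" "\<And>x. Z (Z x) = Q x"
    and Z_comm: "\<And>T x. bounded_linear T \<Longrightarrow> (\<And>x. T (Q x) = Q (T x)) \<Longrightarrow> T (Z x) = Z (T x)"
    using sym_contr_sqrt[OF Q(1)] by blast
  note lin = sym_contrD(1)[OF P(1)] sym_contrD(1)[OF Q(1)]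
  note bl = sym_contr_bounded_linear[OF P(1)]
  have PQ: "P (Q x) = Q (P x)" for x
    by (rule Q_comm[OF bl]) (simp add: linear_diff[OF lin(1)] flip: P(2))
  have PZ: "P (Z x) = Z (P x)" for x
    by (rule Z_comm[OF bl PQ])
  define S where "S = range (\<lambda>x. (P x, Q x))"
  have S_sym: "Q x \<bullet> P y = P x \<bullet> Q y" for x y
    using sym_contrD(2)[OF P(1), of "Q x" y] sym_contrD(2)[OF Q(1), of "P x" y] by (simp add: PQ)
  have "real_adjoint S \<subseteq> S"
  proof clarify
    fix y z assume yz: "(y, z) \<in> real_adjoint S"
    have "Q y = P z"
    proof -
      have "x \<bullet> Q y = x \<bullet> P z" for x
        using real_adjointD[OF yz, of "P x" "Q x"] sym_contrD(2)[OF P(1), of x z]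
          sym_contrD(2)[OF Q(1), of x y] by (simp add: S_def)
      then show ?thesis
        using vector_eq_ldot by blast
    qed
    then have "P (Q z) = y - B y" "Q (P y) = B z"
      using PQ[of z] PQ[of y] Q(2)[of y] P(2)[of z] by simp_all
    \<comment> \<open>Since \<open>P\<^sup>2 + Q\<^sup>2 = 1\<close>, the map
      \<open>x \<mapsto> (P x, Q x)\<close> is an isometry, and its adjoint
      \<open>(y, z) \<mapsto> P y + Q z\<close> supplies the preimage.\<close>
    then have "P (P y + Q z) = y" "Q (P y + Q z) = z"
      using P(2)[of y] Q(2)[of z] linear_add[OF lin(1), of "P y" "Q z"] linear_add[OF lin(2), of "P y" "Q z"]
      by simp_all
    then show "(y, z) \<in> S"
      using rangeI[of "\<lambda>x. (P x, Q x)" "P y + Q z"] by (simp add: S_def)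
  qed
  moreover have "S \<subseteq> real_adjoint S"
    by (auto simp: S_def real_adjoint_def S_sym)
  moreover have "0 \<le> Q x \<bullet> P x" for x
  proof -
    have "Q x \<bullet> P x = Z x \<bullet> P (Z x)"
      using sym_contrD(2)[OF Z(1), of "Z x" "P x"] by (simp add: Z(2) PZ)
    then show ?thesis
      using sym_contrD(3)[OF P(1), of "Z x"] by (simp add: inner_commute)
  qed
  ultimately have S: "pos_selfadjoint S"
    by (auto simp: pos_selfadjoint_def S_def)
  have H_eq: "H = range (\<lambda>h. (B h, h - B h))"
  proof
    show "H \<subseteq> range (\<lambda>h. (B h, h - B h))"
    proof clarify
      fix x u assume "(x, u) \<in> H"
      then have "(x, u) = (B (x + u), x + u - B (x + u))"
        by (simp add: B(3))
      then show "(x, u) \<in> range (\<lambda>h. (B h, h - B h))"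
        by blast
    qed
  qed (use B(2) in auto)
  have "S O S = H"
  proof
    have "(B h, h - B h) \<in> S O S" for h
    proof
      show "(B h, Q (P h)) \<in> S"
        using rangeI[of "\<lambda>x. (P x, Q x)" "P h"] by (simp add: S_def P(2))
      show "(Q (P h), h - B h) \<in> S"
        using rangeI[of "\<lambda>x. (P x, Q x)" "Q h"] by (simp add: S_def PQ Q(2))
    qed
    then show "H \<subseteq> S O S"
      by (auto simp: H_eq)
    \<comment> \<open>The reverse inclusion is maximality of selfadjoint operators:
      \<open>S O S\<close> is symmetric and extends \<open>H\<close>, so it lies in the adjoint of
      \<open>H\<close>.\<close>
    have "(x, z) \<in> real_adjoint H" if "(x, y) \<in> S" "(y, z) \<in> S" for x y z
      unfolding real_adjoint_def
    proof clarify
      fix a c assume "(a, c) \<in> H"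
      then obtain b where "(a, b) \<in> S" "(b, c) \<in> S"
        using \<open>H \<subseteq> S O S\<close> by blast
      then show "c \<bullet> x = a \<bullet> z"
        using pos_selfadjointD(3)[OF S] that by metis
    qed
    then show "S O S \<subseteq> H"
      using H by (auto simp: pos_selfadjoint_def)
  qed
  moreover have "(T x, T u) \<in> S"
    if T: "bounded_linear T" and TH: "\<And>x u. (x, u) \<in> H \<Longrightarrow> (T x, T u) \<in> H" and xu: "(x, u) \<in> S" for T x u
  proof -
    note linT = bounded_linear.linear[OF T]
    have TB: "T (B h) = B (T h)" for h
      using B(3)[OF TH[OF B(2)[of h]]] by (simp add: linear_diff[OF linT])
    have "T (P h) = P (T h)" "T (Q h) = Q (T h)" for h
      using P_comm[OF T] Q_comm[OF T] TB by (auto simp: linear_diff[OF linT])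
    then show ?thesis
      using xu by (auto simp: S_def)
  qed
  ultimately show thesis
    using that S by blast
qed

text \<open>\<open>W = R B\<close> with \<open>B = (1 + H)\<^sup>-\<^sup>1\<close>. As the positive root of \<open>B (1 - B)\<close> it depends on \<open>H\<close> only,
  and it determines \<open>R\<close> on the core \<open>Dom H\<close>.\<close>

lemma pos_selfadjoint_sqrt_bounded:
  fixes H R :: "('a::{real_inner,complete_space} \<times> 'a) set"
  assumes R: "pos_selfadjoint R" and RR: "R O R = H"
    and B: "\<And>h. (B h, h - B h) \<in> H" "\<And>x u. (x, u) \<in> H \<Longrightarrow> B (x + u) = x"
  obtains W where "sym_contr W" "\<And>x. W (W x) = B (x - B x)" "\<And>x. (B x, W x) \<in> R"
proof -
  note RD = pos_selfadjointD[OF R]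
  have "\<exists>c. (B x, c) \<in> R \<and> (c, x - B x) \<in> R" for x
    using B(1)[of x] RR by blast
  then obtain W where W: "\<And>x. (B x, W x) \<in> R" "\<And>x. (W x, x - B x) \<in> R"
    by metis
  \<comment> \<open>Two candidates differ by some \<open>w\<close> with both \<open>(0, w)\<close>
    and \<open>(w, 0)\<close> in \<open>R\<close>; symmetry of \<open>R\<close> gives
    \<open>w \<bullet> w = 0\<close>.\<close>
  have uniq: "W x = c" if "(B x, c) \<in> R" "(c, x - B x) \<in> R" for x c
  proof -
    have "(0, W x - c) \<in> R" "(W x - c, 0) \<in> R"
      using RD(6)[OF W(1)[of x] that(1)] RD(6)[OF W(2)[of x] that(2)] by simp_all
    from RD(3)[OF this] show ?thesis
      by simp
  qed
  have B_eq: "B x = y" if "(y, x - y) \<in> H" for x y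
    using B(2)[OF that] by simp
  have add: "(a + b, c + d) \<in> H" if "(a, c) \<in> H" "(b, d) \<in> H" for a b c d
    using that RD(5) unfolding RR[symmetric] by blast
  have scale: "(r *\<^sub>R a, r *\<^sub>R c) \<in> H" if "(a, c) \<in> H" for a c r
    using that RD(7) unfolding RR[symmetric] by blast
  have B_add: "B (x + y) = B x + B y" for x y
    using add[OF B(1)[of x] B(1)[of y]] by (intro B_eq) (simp add: algebra_simps)
  have B_scale: "B (r *\<^sub>R x) = r *\<^sub>R B x" for r x
    using scale[OF B(1)[of x], of r] by (intro B_eq) (simp add: algebra_simps)
  have W_apply: "W x = B u" if "(x, u) \<in> R" for x u
  proof -
    \<comment> \<open>This shows that \<open>R\<close> commutes with the resolvent:
      \<open>R B x = B R x\<close> on the domain of \<open>R\<close>.\<close>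
    have "(W x, u - W x) \<in> R O R"
      using W(2)[of x] RD(6)[OF that W(1)[of x]] by blast
    then show ?thesis
      using B_eq by (simp add: RR)
  qed
  have "linear W"
  proof (rule linearI)
    show "W (x + y) = W x + W y" for x y
      using RD(5)[OF W(1)[of x] W(1)[of y]] RD(5)[OF W(2)[of x] W(2)[of y]]
      by (intro uniq) (simp_all add: B_add algebra_simps)
    show "W (r *\<^sub>R x) = r *\<^sub>R W x" for r x
      using RD(7)[OF W(1)[of x], of r] RD(7)[OF W(2)[of x], of r]
      by (intro uniq) (simp_all add: B_scale algebra_simps)
  qed
  moreover have "W x \<bullet> y = x \<bullet> W y" for x y
    using RD(3)[OF W(1)[of x] W(1)[of y]] RD(3)[OF W(2)[of x] W(2)[of y]]
    by (simp add: inner_diff_left inner_diff_right)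
  moreover have "0 \<le> W x \<bullet> x" for x
    using RD(4)[OF W(1)[of x]] RD(4)[OF W(2)[of x]]
    by (simp add: inner_diff_left inner_diff_right inner_commute)
  moreover have "W x \<bullet> x \<le> x \<bullet> x" for x
  proof -
    have "W x \<bullet> W x = B x \<bullet> (x - B x)"
      by (rule RD(3)[OF W])
    \<comment> \<open>The relation says that the squared norms of \<open>W x\<close> and
      \<open>B x\<close> add up to \<open>B x \<bullet> x\<close>; completing both squares leaves
      half of \<open>x \<bullet> x\<close>.\<close>
    then have "x \<bullet> x - W x \<bullet> x = (W x - (1/2) *\<^sub>R x) \<bullet> (W x - (1/2) *\<^sub>R x)
        + (B x - (1/2) *\<^sub>R x) \<bullet> (B x - (1/2) *\<^sub>R x) + (1/2) * (x \<bullet> x)"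
      by (simp add: inner_diff_left inner_diff_right inner_commute field_simps)
    also have "\<dots> \<ge> 0"
      by (intro add_nonneg_nonneg) auto
    finally show ?thesis
      by simp
  qed
  ultimately have "sym_contr W"
    by (simp add: sym_contr_def)
  moreover have "W (W x) = B (x - B x)" for x
    by (rule W_apply[OF W(2)])
  ultimately show thesis
    using that W(1) by blast
qed

text \<open>Both roots have the same \<open>W\<close>, by injectivity of squaring on positive
  contractions, so they agree on \<open>Dom H = range B\<close>. This is a core of each, because
  \<open>T\<^sup>*T = T\<^sup>2 = H\<close> for a selfadjoint root \<open>T\<close>.\<close>

lemma pos_selfadjoint_sqrt_unique:
  fixes R S :: "('a::{real_inner,complete_space} \<times> 'a) set"
  assumes H: "pos_selfadjoint H"
    and R: "pos_selfadjoint R" "single_valued R" "R O R = H"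
    and S: "pos_selfadjoint S" "single_valued S" "S O S = H"
  shows "R = S"
proof -
  obtain B where "sym_contr B"
    and B: "\<And>h. (B h, h - B h) \<in> H" "\<And>x u. (x, u) \<in> H \<Longrightarrow> B (x + u) = x"
    using resolvent[OF H] by blast
  have Dom_H: "Domain H = range B"
  proof
    show "Domain H \<subseteq> range B"
    proof
      fix x assume "x \<in> Domain H"
      then obtain u where "(x, u) \<in> H"
        by blast
      then show "x \<in> range B"
        using rangeI[of B "x + u"] by (simp add: B(2))
    qed
    show "range B \<subseteq> Domain H"
      using B(1) by blast
  qed
  obtain W where W: "sym_contr W" "\<And>x. W (W x) = B (x - B x)" "\<And>x. (B x, W x) \<in> R"
    using pos_selfadjoint_sqrt_bounded[OF R(1,3) B] by blast
  obtain V where V: "sym_contr V" "\<And>x. V (V x) = B (x - B x)" "\<And>x. (B x, V x) \<in> S"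
    using pos_selfadjoint_sqrt_bounded[OF S(1,3) B] by blast
  have "W = V"
    by (rule sym_contr_square_inj[OF W(1) V(1)]) (simp add: W V)
  have core: "T = closure (range (\<lambda>h. (B h, W h)))"
    if T: "pos_selfadjoint T" "single_valued T" "T O T = H" and "\<And>x. (B x, W x) \<in> T" for T
  proof -
    have "{(x, u) \<in> T. x \<in> Domain H} = range (\<lambda>h. (B h, W h))"
      using that(4) T(2) unfolding Dom_H by (auto simp: single_valued_def)
    moreover have "closure {(x, u) \<in> T. x \<in> Domain (T O real_adjoint T)} = T"
      by (rule core_of_closed_operator[OF pos_selfadjointD(1,2)[OF T(1)] T(2)])
    moreover have "T O real_adjoint T = H"
      using T(1,3) by (simp add: pos_selfadjoint_def)
    ultimately show ?thesis
      by simp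
  qed
  show ?thesis
    using core[OF R W(3)] core[OF S] V(3) \<open>W = V\<close> by simp
qed

section \<open>Operators and completions in complex Hilbert spaces\<close>

lemma cinner_scaleC_right: "cinner x (c *\<^sub>C y) = cnj c * cinner x y"
  by (metis cinner_commute cinner_scaleC_left complex_cnj_mult)

lemma Im_cinner: "Im (cinner x y) = x \<bullet> (\<i> *\<^sub>C y)"
  by (simp add: inner_eq_Re_cinner cinner_scaleC_right)

lemma cinner_eq_Complex: "cinner x y = Complex (x \<bullet> y) (x \<bullet> (\<i> *\<^sub>C y))"
  by (simp add: complex_eq_iff Im_cinner inner_eq_Re_cinner)

lemma norm_scaleC: "norm (c *\<^sub>C (x::'a::chilbert_space)) = cmod c * norm x"
proof -
  have "cinner (c *\<^sub>C x) (c *\<^sub>C x) = complex_of_real ((cmod c)\<^sup>2) * cinner x x"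
    unfolding complex_norm_square by (simp add: cinner_scaleC_left cinner_scaleC_right)
  then have "(norm (c *\<^sub>C x))\<^sup>2 = (cmod c * norm x)\<^sup>2"
    by (simp add: power2_norm_eq_inner inner_eq_Re_cinner power_mult_distrib)
  then show ?thesis
    by (simp add: power2_eq_iff_nonneg)
qed

lemma bounded_linear_scaleC: "bounded_linear (\<lambda>x::'a::chilbert_space. c *\<^sub>C x)"
proof (rule bounded_linear_intro[where K = "cmod c"])
  show "c *\<^sub>C (r *\<^sub>R x) = r *\<^sub>R (c *\<^sub>C x)" for r and x :: 'a
    by (simp add: scaleC_scaleC mult.commute flip: scaleC_of_real)
qed (simp_all add: scaleC_add_right norm_scaleC mult.commute)

lemma cmod_cinner_le: "cmod (cinner x y) \<le> norm (x::'a::chilbert_space) * norm y"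
proof (cases "cinner x y = 0")
  case False
  \<comment> \<open>A phase that rotates the inner product onto the positive real axis, reducing the
    claim to the real Cauchy-Schwarz inequality.\<close>
  define c where "c = cnj (cinner x y) / cmod (cinner x y)"
  have "cinner (c *\<^sub>C x) y = complex_of_real (cmod (cinner x y))"
    using False complex_norm_square[of "cinner x y"]
    by (simp add: cinner_scaleC_left c_def field_simps power2_eq_square)
  then have "cmod (cinner x y) = (c *\<^sub>C x) \<bullet> y"
    by (simp add: inner_eq_Re_cinner)
  also have "\<dots> \<le> norm (c *\<^sub>C x) * norm y"
    by (rule norm_cauchy_schwarz)
  also have "norm (c *\<^sub>C x) = norm x"
    using False by (simp add: norm_scaleC c_def norm_divide)
  finally show ?thesis .
qed simp

lemma tendsto_cinner:
  fixes a b :: "'i \<Rightarrow> 'a::chilbert_space"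
  assumes "(a \<longlongrightarrow> x) F" "(b \<longlongrightarrow> y) F"
  shows "((\<lambda>n. cinner (a n) (b n)) \<longlongrightarrow> cinner x y) F"
  unfolding cinner_eq_Complex
  by (intro tendsto_Complex tendsto_inner assms bounded_linear.tendsto[OF bounded_linear_scaleC])

lemma scaleC_minus1: "(-1) *\<^sub>C x = - (x::'a::chilbert_space)"
  using scaleC_of_real[of "-1" x] by simp

lemma norm_power2_cinner: "(norm (x::'a::chilbert_space))\<^sup>2 = Re (cinner x x)"
  by (simp add: power2_norm_eq_inner inner_eq_Re_cinner)

lemma cinner_self: "cinner x x = complex_of_real ((norm (x::'a::chilbert_space))\<^sup>2)"
proof -
  have "Im (cinner x x) = - Im (cinner x x)"
    using arg_cong[OF cinner_commute[of x x], of Im] by simp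
  then show ?thesis
    by (simp add: complex_eq_iff norm_power2_cinner)
qed

lemma linear_opD:
  assumes "linear_op T"
  shows "single_valued T" "(0, 0) \<in> T" "(x, u) \<in> T \<Longrightarrow> (y, v) \<in> T \<Longrightarrow> (x + y, u + v) \<in> T"
    "(x, u) \<in> T \<Longrightarrow> (c *\<^sub>C x, c *\<^sub>C u) \<in> T"
    "(x, u) \<in> T \<Longrightarrow> (y, v) \<in> T \<Longrightarrow> (x - y, u - v) \<in> T"
proof -
  show add: "(x, u) \<in> T \<Longrightarrow> (y, v) \<in> T \<Longrightarrow> (x + y, u + v) \<in> T" for x y u v
    using assms by (auto simp: linear_op_def)
  show scale: "(x, u) \<in> T \<Longrightarrow> (c *\<^sub>C x, c *\<^sub>C u) \<in> T" for x u c
    using assms by (auto simp: linear_op_def)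
  show "(x, u) \<in> T \<Longrightarrow> (y, v) \<in> T \<Longrightarrow> (x - y, u - v) \<in> T"
    using add[of x u "- y" "- v"] scale[of y v "-1"] by (simp add: scaleC_minus1)
qed (use assms in \<open>auto simp: linear_op_def\<close>)

lemma linear_op_converse: "linear_op T \<Longrightarrow> single_valued (T\<inverse>) \<Longrightarrow> linear_op (T\<inverse>)"
  by (auto simp: linear_op_def)

lemma subspace_linear_op: "linear_op T \<Longrightarrow> subspace T"
  using linear_opD(2-4)[of T] unfolding subspace_def zero_prod_def
  by (auto simp flip: scaleC_of_real)

lemma adjoint_op_eq_real_adjoint:
  assumes T: "linear_op T"
  shows "adjoint_op T = real_adjoint T"
proof
  show "adjoint_op T \<subseteq> real_adjoint T"
    unfolding adjoint_op_def real_adjoint_def inner_eq_Re_cinner by fastforce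
  show "real_adjoint T \<subseteq> adjoint_op T"
  proof clarify
    fix y z assume yz: "(y, z) \<in> real_adjoint T"
    have "cinner u y = cinner x z" if xu: "(x, u) \<in> T" for x u
    proof (rule complex_eqI)
      show "Re (cinner u y) = Re (cinner x z)"
        using real_adjointD[OF yz xu] by (simp add: inner_eq_Re_cinner)
      show "Im (cinner u y) = Im (cinner x z)"
        using real_adjointD[OF yz linear_opD(4)[OF T xu, of "\<i>"]]
        by (simp add: inner_eq_Re_cinner cinner_scaleC_left)
    qed
    then show "(y, z) \<in> adjoint_op T"
      by (auto simp: adjoint_op_def)
  qed
qed

lemma adjoint_opD: "(y, z) \<in> adjoint_op T \<Longrightarrow> (x, u) \<in> T \<Longrightarrow> cinner u y = cinner x z"
  by (auto simp: adjoint_op_def)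

text \<open>The defining equations are the same with the components of each pair exchanged. This is
  what turns the inverse of \<open>j j\<^sup>*\<close> into \<open>J\<^sup>*J\<close>.\<close>

lemma adjoint_op_converse: "adjoint_op (T\<inverse>) = (adjoint_op T)\<inverse>"
proof -
  have "(y, z) \<in> adjoint_op (T\<inverse>) \<longleftrightarrow> (z, y) \<in> adjoint_op T" for y z
    unfolding adjoint_op_def by (simp add: Ball_def split_paired_All) metis
  then show ?thesis
    by auto
qed

lemma pos_selfadjoint_if:
  assumes "selfadjoint_op H" "positive_op H"
  shows "pos_selfadjoint H"
  using assms adjoint_op_eq_real_adjoint[of H]
  by (auto simp: selfadjoint_op_def positive_op_def pos_selfadjoint_def inner_eq_Re_cinner
      complex_nonneg_Reals_iff)

lemma eq_0_if_orthogonal_dense: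
  fixes d :: "'a::real_inner"
  assumes "closure D = UNIV" and "\<And>x. x \<in> D \<Longrightarrow> x \<bullet> d = 0"
  shows "d = 0"
proof -
  have "closed {x. x \<bullet> d = 0}"
    by (intro closed_Collect_eq continuous_intros)
  then have "closure D \<subseteq> {x. x \<bullet> d = 0}"
    using assms(2) by (intro closure_minimal) auto
  then have "d \<bullet> d = 0"
    using assms(1) by blast
  then show ?thesis
    by simp
qed

text \<open>Discharges the definite description. The real theory supplies the root and its
  uniqueness; density of the domain gives single-valuedness, and the complex structure has to be
  recovered.\<close>

lemma sqrt_op:
  assumes H: "selfadjoint_op H" "positive_op H"
  shows "selfadjoint_op (sqrt_op H)" "positive_op (sqrt_op H)" "sqrt_op H O sqrt_op H = H"
proof -
  note pH = pos_selfadjoint_if[OF H]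
  obtain S where S: "pos_selfadjoint S" "S O S = H"
    and comm: "\<And>T x u. bounded_linear T \<Longrightarrow> (\<And>x u. (x, u) \<in> H \<Longrightarrow> (T x, T u) \<in> H)
      \<Longrightarrow> (x, u) \<in> S \<Longrightarrow> (T x, T u) \<in> S"
    using pos_selfadjoint_sqrt[OF pH] by blast
  note SD = pos_selfadjointD[OF S(1)]
  have linH: "linear_op H"
    using H by (simp add: selfadjoint_op_def)
  have "Domain H \<subseteq> Domain S"
    using S(2) by blast
  then have dense: "closure (Domain S) = UNIV"
    using H(1) closure_mono[of "Domain H" "Domain S"] by (auto simp: selfadjoint_op_def densely_defined_def)
  have "single_valued S"
  proof (rule single_valuedI)
    fix x u v assume "(x, u) \<in> S" "(x, v) \<in> S"
    then have "(0, u - v) \<in> S"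
      using SD(6) by force
    then have "u - v = 0"
      using SD(3) by (intro eq_0_if_orthogonal_dense[OF dense]) (force elim: DomainE)
    then show "u = v"
      by simp
  qed
  \<comment> \<open>Multiplication by \<open>c\<close> is a bounded real-linear map preserving the
    graph of \<open>H\<close>, hence also that of its root.\<close>
  moreover have "(c *\<^sub>C x, c *\<^sub>C u) \<in> S" if "(x, u) \<in> S" for c x u
    using that linear_opD(4)[OF linH] by (intro comm[of "\<lambda>x. c *\<^sub>C x"] bounded_linear_scaleC)
  moreover have "(0, 0) \<in> S"
    using subspace_0[OF SD(1)] by (simp add: zero_prod_def)
  ultimately have linS: "linear_op S"
    using SD(5) by (auto simp: linear_op_def)
  then have adjS: "adjoint_op S = S"
    using S(1) by (simp add: adjoint_op_eq_real_adjoint pos_selfadjoint_def)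
  with linS dense have sa: "selfadjoint_op S"
    by (simp add: selfadjoint_op_def densely_defined_def)
  have "cinner u x \<in> \<real>\<^sub>\<ge>\<^sub>0" if xu: "(x, u) \<in> S" for x u
  proof -
    have "cinner u x = cnj (cinner u x)"
      using adjoint_opD[of x u S x u] xu adjS cinner_commute[of x u] by simp
    then have "Im (cinner u x) = 0"
      by (metis Reals_cnj_iff complex_is_Real_iff)
    then show ?thesis
      using SD(4)[OF xu] by (simp add: complex_nonneg_Reals_iff inner_eq_Re_cinner)
  qed
  then have pos: "positive_op S"
    by (auto simp: positive_op_def)
  have S_unique: "R = S" if R: "selfadjoint_op R \<and> positive_op R \<and> R O R = H" for R
  proof (rule pos_selfadjoint_sqrt_unique[OF pH _ _ _ S(1) linear_opD(1)[OF linS] S(2)])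
    show "pos_selfadjoint R" "single_valued R" "R O R = H"
      using R by (simp_all add: pos_selfadjoint_if selfadjoint_op_def linear_opD(1))
  qed
  have "selfadjoint_op (sqrt_op H) \<and> positive_op (sqrt_op H) \<and> sqrt_op H O sqrt_op H = H"
    unfolding sqrt_op_def
    by (rule theI[where P = "\<lambda>S. selfadjoint_op S \<and> positive_op S \<and> S O S = H", OF _ S_unique])
      (intro conjI sa pos S(2))
  then show "selfadjoint_op (sqrt_op H)" "positive_op (sqrt_op H)" "sqrt_op H O sqrt_op H = H"
    by auto
qed

lemma norm_eq_SUP:
  fixes g :: "'a::chilbert_space"
  assumes D: "closure D = UNIV"
  shows "ennreal (norm g) = (SUP w \<in> {w \<in> D. w \<noteq> 0}. ennreal (cmod (cinner w g) / norm w))"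
proof (rule antisym)
  show "(SUP w \<in> {w \<in> D. w \<noteq> 0}. ennreal (cmod (cinner w g) / norm w)) \<le> ennreal (norm g)"
  proof (rule SUP_least)
    fix w assume "w \<in> {w \<in> D. w \<noteq> 0}"
    then show "ennreal (cmod (cinner w g) / norm w) \<le> ennreal (norm g)"
      using cmod_cinner_le[of w g] by (intro ennreal_leI) (simp add: field_simps)
  qed
  show "ennreal (norm g) \<le> (SUP w \<in> {w \<in> D. w \<noteq> 0}. ennreal (cmod (cinner w g) / norm w))"
  proof (cases "g = 0")
    case False
    obtain s where s: "\<And>n. s n \<in> D" "s \<longlonglongrightarrow> g"
      using D closure_sequential[of g D] by auto
    have ne: "\<forall>\<^sub>F n in sequentially. s n \<noteq> 0"
      using tendsto_imp_eventually_ne[OF s(2) False] .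
    have "(\<lambda>n. cmod (cinner (s n) g) / norm (s n)) \<longlonglongrightarrow> cmod (cinner g g) / norm g"
      using False by (intro tendsto_intros tendsto_cinner s) simp
    also have "cinner g g = complex_of_real ((norm g)\<^sup>2)"
      by (rule cinner_self)
    also have "cmod (complex_of_real ((norm g)\<^sup>2)) / norm g = norm g"
      using False by (simp add: power2_eq_square norm_mult)
    finally have "(\<lambda>n. ennreal (cmod (cinner (s n) g) / norm (s n))) \<longlonglongrightarrow> ennreal (norm g)"
      by (rule tendsto_ennrealI)
    then show ?thesis
    proof (rule tendsto_upperbound)
      show "\<forall>\<^sub>F n in sequentially. ennreal (cmod (cinner (s n) g) / norm (s n))
          \<le> (SUP w \<in> {w \<in> D. w \<noteq> 0}. ennreal (cmod (cinner w g) / norm w))"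
        using ne by eventually_elim (use s(1) in \<open>auto intro!: SUP_upper\<close>)
    qed simp
  qed simp
qed

lemma closed_converse: "closed (T\<inverse>)" if "closed T" for T :: "('a::topological_space \<times> 'b::topological_space) set"
proof -
  have "T\<inverse> = (\<lambda>p. (snd p, fst p)) -` T"
    by auto
  moreover have "closed \<dots>"
    by (intro closed_vimage that continuous_intros)
  ultimately show ?thesis
    by simp
qed

lemma closed_embedding_converse:
  "closed_embedding j \<Longrightarrow> closure (Range j) = UNIV \<Longrightarrow> closed_embedding (j\<inverse>)"
  by (auto simp: closed_embedding_def densely_defined_def linear_op_converse closed_converse
      linear_opD(1))

section \<open>Completions of \<open>Domain T\<close> in the norm of \<open>T x\<close>, to be
  applied to \<open>S\<close> and to its inverse\<close>

context
  fixes T :: "('v::chilbert_space \<times> 'w::chilbert_space) set" and i :: "'v \<Rightarrow> 'k::chilbert_space"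
  assumes T: "linear_op T"
    and i: "hilbert_completion (Domain T) (\<lambda>x y. cinner (op_app T x) (op_app T y)) i"
begin

lemma completion_cinner: "(x, u) \<in> T \<Longrightarrow> (y, v) \<in> T \<Longrightarrow> cinner (i x) (i y) = cinner u v"
  using i linear_opD(1)[OF T] by (auto simp: hilbert_completion_def op_app_eq Domain.DomainI)

lemma completion_norm: "(x, u) \<in> T \<Longrightarrow> norm (i x) = norm u"
  using completion_cinner[of x u x u] norm_power2_cinner[of "i x"] norm_power2_cinner[of u]
  by (simp add: norm_eq_sqrt_inner inner_eq_Re_cinner)

lemma completion_diff:
  assumes "x \<in> Domain T" "y \<in> Domain T"
  shows "i (x - y) = i x - i y"
proof -
  have "x - y \<in> Domain T"
    using assms linear_opD(5)[OF T] by blast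
  then have "i ((x - y) + y) = i (x - y) + i y"
    using i assms unfolding hilbert_completion_def by blast
  then show ?thesis
    by simp
qed

lemma completion_norm_diff:
  "(x, u) \<in> T \<Longrightarrow> (y, v) \<in> T \<Longrightarrow> norm (i x - i y) = norm (u - v)"
  using completion_norm[OF linear_opD(5)[OF T]] completion_diff by (metis Domain.DomainI)

text \<open>\<open>i x \<mapsto> T x\<close> is isometric, so convergence in the completion
  transfers to the values of \<open>T\<close>; the vectors \<open>s n\<close> themselves need not
  converge.\<close>

lemma completion_sequence:
  assumes s: "\<And>n. s n \<in> Domain T" and lim: "(\<lambda>n. i (s n)) \<longlonglongrightarrow> z"
  obtains r g where "\<And>n. (s n, r n) \<in> T" "r \<longlonglongrightarrow> g"
proof -
  obtain r where r: "\<And>n. (s n, r n) \<in> T"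
    using s unfolding Domain_iff by metis
  have "Cauchy (\<lambda>n. i (s n))"
    using lim by (rule LIMSEQ_imp_Cauchy)
  then have "Cauchy r"
    unfolding Cauchy_def dist_norm completion_norm_diff[OF r r] .
  then show thesis
    using that r Cauchy_convergent convergent_def by blast
qed

text \<open>\<open>g\<close> is the image of \<open>z\<close> under the isometric extension of
  \<open>i x \<mapsto> T x\<close>.\<close>

lemma completion_represent: "\<exists>g. \<forall>(x, u) \<in> T. cinner (i x) z = cinner u g"
proof -
  have "z \<in> closure (i ` Domain T)"
    using i by (simp add: hilbert_completion_def)
  then obtain t where t: "\<And>n. t n \<in> i ` Domain T" "t \<longlonglongrightarrow> z"
    unfolding closure_sequential by blast
  have "\<forall>n. \<exists>x\<in>Domain T. t n = i x"
    using t(1) by blast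
  then obtain s where s: "\<And>n. s n \<in> Domain T" "\<And>n. t n = i (s n)"
    by metis
  have "(\<lambda>n. i (s n)) \<longlonglongrightarrow> z"
    using t(2) unfolding s(2)[symmetric] .
  with s(1) obtain r g where r: "\<And>n. (s n, r n) \<in> T" "r \<longlonglongrightarrow> g"
    using completion_sequence by metis
  have "cinner (i x) z = cinner u g" if "(x, u) \<in> T" for x u
  proof (rule LIMSEQ_unique)
    show "(\<lambda>n. cinner (i x) (t n)) \<longlonglongrightarrow> cinner (i x) z"
      by (intro tendsto_cinner t tendsto_const)
    show "(\<lambda>n. cinner (i x) (t n)) \<longlonglongrightarrow> cinner u g"
      unfolding s(2) completion_cinner[OF that r(1)] by (intro tendsto_cinner r tendsto_const)
  qed
  then show ?thesis
    by blast
qed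

text \<open>If \<open>i (s n)\<close> and \<open>s n\<close> both converge, so do the values of
  \<open>T\<close>; closedness of \<open>T\<close> puts the limit of \<open>s\<close> into
  \<open>Domain T\<close>, and the isometry identifies the limit of \<open>i (s n)\<close>.
  Injectivity of \<open>T\<close> makes \<open>i\<close> injective.\<close>

lemma closed_embedding_completion:
  assumes "closed T" "single_valued (T\<inverse>)" "closure (Domain T) = UNIV"
  shows "closed_embedding {(i x, x) | x. x \<in> Domain T}" (is "closed_embedding ?j")
proof -
  have "x = y" if xy: "x \<in> Domain T" "y \<in> Domain T" "i x = i y" for x y
  proof -
    obtain u v where uv: "(x, u) \<in> T" "(y, v) \<in> T"
      using xy by blast
    then have "u = v"
      using completion_norm_diff[OF uv] xy(3) by simp
    with uv assms(2) show ?thesis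
      by (auto simp: single_valued_def)
  qed
  then have "single_valued ?j"
    by (auto simp: single_valued_def)
  moreover have "single_valued (?j\<inverse>)"
    by (auto simp: single_valued_def)
  moreover have "0 \<in> Domain T" "i 0 = 0"
    using linear_opD(2)[OF T] completion_diff[of 0 0] by auto
  moreover have "x + y \<in> Domain T \<and> i x + i y = i (x + y)" if "x \<in> Domain T" "y \<in> Domain T" for x y
    using i that linear_opD(3)[OF T] unfolding hilbert_completion_def by (metis DomainE Domain.DomainI)
  moreover have "c *\<^sub>C x \<in> Domain T \<and> c *\<^sub>C i x = i (c *\<^sub>C x)" if "x \<in> Domain T" for c x
    using i that linear_opD(4)[OF T] unfolding hilbert_completion_def by (metis DomainE Domain.DomainI)
  ultimately have "linear_op ?j"
    unfolding linear_op_def by auto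
  moreover have "Domain ?j = i ` Domain T"
    by auto
  then have "densely_defined ?j"
    using i by (simp add: hilbert_completion_def densely_defined_def)
  moreover have "closed ?j"
    unfolding closed_sequential_limits
  proof (intro allI impI, elim conjE)
    fix p l assume p: "\<forall>n. p n \<in> ?j" and l: "p \<longlonglongrightarrow> l"
    define s where "s n = snd (p n)" for n
    have s: "s n \<in> Domain T" "p n = (i (s n), s n)" for n
      using p[THEN spec, of n] by (auto simp: s_def)
    have lim: "(\<lambda>n. i (s n)) \<longlonglongrightarrow> fst l" "s \<longlonglongrightarrow> snd l"
      using tendsto_fst[OF l] tendsto_snd[OF l] by (auto simp: s(2))
    obtain r g where r: "\<And>n. (s n, r n) \<in> T" "r \<longlonglongrightarrow> g"
      using completion_sequence[OF s(1) lim(1)] by blast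
    have "(\<lambda>n. (s n, r n)) \<longlonglongrightarrow> (snd l, g)"
      by (intro tendsto_intros lim r)
    then have lg: "(snd l, g) \<in> T"
      by (rule closed_sequentially[OF assms(1) r(1)])
    have "(\<lambda>n. norm (i (s n) - i (snd l))) \<longlonglongrightarrow> norm (g - g)"
      unfolding completion_norm_diff[OF r(1) lg] by (intro tendsto_intros r)
    then have "(\<lambda>n. i (s n)) \<longlonglongrightarrow> i (snd l)"
      by (subst LIM_zero_iff[symmetric], subst tendsto_norm_zero_iff[symmetric]) simp
    then have "fst l = i (snd l)"
      by (rule LIMSEQ_unique[OF lim(1)])
    then have "l = (i (snd l), snd l)"
      by (simp add: prod_eq_iff)
    then show "l \<in> ?j"
      using lg by blast
  qed
  ultimately show ?thesis
    using \<open>single_valued (?j\<inverse>)\<close> by (simp add: closed_embedding_def)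
qed

end

section \<open>Triplets with a given Hamiltonian\<close>

lemma hilbert_completion_sequence:
  assumes i: "hilbert_completion V ip i" and f: "hilbert_completion V ip f"
    and V: "\<And>x y. x \<in> V \<Longrightarrow> y \<in> V \<Longrightarrow> x - y \<in> V"
  obtains s p where "\<And>n. s n \<in> V" "(\<lambda>n. i (s n)) \<longlonglongrightarrow> d" "(\<lambda>n. f (s n)) \<longlonglongrightarrow> p"
proof -
  have "d \<in> closure (i ` V)"
    using i by (simp add: hilbert_completion_def)
  then obtain t where t: "\<And>n. t n \<in> i ` V" "t \<longlonglongrightarrow> d"
    unfolding closure_sequential by blast
  have "\<forall>n. \<exists>x\<in>V. t n = i x"
    using t(1) by blast
  then obtain s where s: "\<And>n. s n \<in> V" "\<And>n. t n = i (s n)"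
    by metis
  have lim: "(\<lambda>n. i (s n)) \<longlonglongrightarrow> d"
    using t(2) unfolding s(2)[symmetric] .
  have diff: "g (x - y) = g x - g y" if "hilbert_completion V ip g" "x \<in> V" "y \<in> V"
    for x y and g :: "'a \<Rightarrow> 'z::chilbert_space"
  proof -
    have "g ((x - y) + y) = g (x - y) + g y"
      using that V unfolding hilbert_completion_def by blast
    then show ?thesis
      by simp
  qed
  have "norm (f (s m) - f (s n)) = norm (i (s m) - i (s n))" for m n
  proof -
    have "cinner (f (s m - s n)) (f (s m - s n)) = cinner (i (s m - s n)) (i (s m - s n))"
      using i f V s(1) by (simp add: hilbert_completion_def)
    then show ?thesis
      by (simp add: norm_eq_sqrt_inner inner_eq_Re_cinner diff[OF i] diff[OF f] s(1))
  qed
  moreover have "Cauchy (\<lambda>n. i (s n))"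
    using lim by (rule LIMSEQ_imp_Cauchy)
  ultimately have "Cauchy (\<lambda>n. f (s n))"
    unfolding Cauchy_def dist_norm by simp
  then show thesis
    using that s(1) lim Cauchy_convergent convergent_def by blast
qed

lemma hilbert_completion_unitary:
  fixes i :: "'v::chilbert_space \<Rightarrow> 'a::chilbert_space" and f :: "'v \<Rightarrow> 'b::chilbert_space"
  assumes i: "hilbert_completion V ip i" and f: "hilbert_completion V ip f"
    and V_add: "\<And>x y. x \<in> V \<Longrightarrow> y \<in> V \<Longrightarrow> x + y \<in> V"
    and V_scale: "\<And>c x. x \<in> V \<Longrightarrow> c *\<^sub>C x \<in> V"
  obtains \<Phi> where "unitary_map \<Phi>" "\<And>x. x \<in> V \<Longrightarrow> \<Phi> (i x) = f x"
proof -
  \<comment> \<open>The unitary is built as a relation between limits. \<open>G\<close> is symmetric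
    in \<open>i\<close> and \<open>f\<close>, so surjectivity is totality with the two roles
    exchanged.\<close>
  define G where "G d p \<longleftrightarrow> (\<exists>s. (\<forall>n. s n \<in> V) \<and> (\<lambda>n. i (s n)) \<longlonglongrightarrow> d \<and> (\<lambda>n. f (s n)) \<longlonglongrightarrow> p)"
    for d p
  have V_diff: "x - y \<in> V" if "x \<in> V" "y \<in> V" for x y
    using V_add[OF that(1) V_scale[OF that(2), of "-1"]] by (simp add: scaleC_minus1)
  have total: "\<exists>p. G d p" for d
    unfolding G_def using hilbert_completion_sequence[OF i f V_diff] by metis
  have onto: "\<exists>d. G d p" for p
    unfolding G_def using hilbert_completion_sequence[OF f i V_diff] by metis
  have G_base: "G (i x) (f x)" if "x \<in> V" for x
    unfolding G_def using that by (intro exI[of _ "\<lambda>n. x"]) auto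
  have G_cinner: "cinner p q = cinner d e" if G: "G d p" "G e q" for d e p q
  proof -
    obtain s t where s: "\<And>n. s n \<in> V" "(\<lambda>n. i (s n)) \<longlonglongrightarrow> d" "(\<lambda>n. f (s n)) \<longlonglongrightarrow> p"
      and t: "\<And>n. t n \<in> V" "(\<lambda>n. i (t n)) \<longlonglongrightarrow> e" "(\<lambda>n. f (t n)) \<longlonglongrightarrow> q"
      using G unfolding G_def by blast
    have "cinner (f (s n)) (f (t n)) = cinner (i (s n)) (i (t n))" for n
      using i f s(1) t(1) by (simp add: hilbert_completion_def)
    then have "(\<lambda>n. cinner (i (s n)) (i (t n))) \<longlonglongrightarrow> cinner p q"
      using tendsto_cinner[OF s(3) t(3)] by simp
    then show ?thesis
      using tendsto_cinner[OF s(2) t(2)] LIMSEQ_unique by blast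
  qed
  have G_add: "G (d + e) (p + q)" if G: "G d p" "G e q" for d e p q
  proof -
    obtain s t where s: "\<And>n. s n \<in> V" "(\<lambda>n. i (s n)) \<longlonglongrightarrow> d" "(\<lambda>n. f (s n)) \<longlonglongrightarrow> p"
      and t: "\<And>n. t n \<in> V" "(\<lambda>n. i (t n)) \<longlonglongrightarrow> e" "(\<lambda>n. f (t n)) \<longlonglongrightarrow> q"
      using G unfolding G_def by blast
    have "i (s n + t n) = i (s n) + i (t n)" "f (s n + t n) = f (s n) + f (t n)" for n
      using i f s(1) t(1) by (simp_all add: hilbert_completion_def)
    then show ?thesis
      unfolding G_def using s t V_add
      by (intro exI[of _ "\<lambda>n. s n + t n"]) (simp add: tendsto_add)
  qed
  have G_scale: "G (c *\<^sub>C d) (c *\<^sub>C p)" if G: "G d p" for c d p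
  proof -
    obtain s where s: "\<And>n. s n \<in> V" "(\<lambda>n. i (s n)) \<longlonglongrightarrow> d" "(\<lambda>n. f (s n)) \<longlonglongrightarrow> p"
      using G unfolding G_def by blast
    have "i (c *\<^sub>C s n) = c *\<^sub>C i (s n)" "f (c *\<^sub>C s n) = c *\<^sub>C f (s n)" for n
      using i f s(1) by (simp_all add: hilbert_completion_def)
    then show ?thesis
      unfolding G_def using s V_scale
      by (intro exI[of _ "\<lambda>n. c *\<^sub>C s n"]) (simp add: bounded_linear.tendsto[OF bounded_linear_scaleC])
  qed
  have G_unique: "p = q" if "G d p" "G d q" for d p q
  proof -
    have "G (d + (-1) *\<^sub>C d) (p + (-1) *\<^sub>C q)"
      using that by (intro G_add G_scale)
    from G_cinner[OF this this] have "cinner (p - q) (p - q) = cinner 0 (0 :: 'a)"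
      by (simp add: scaleC_minus1)
    then have "norm (p - q) = norm (0 :: 'a)"
      by (simp only: norm_eq_sqrt_inner inner_eq_Re_cinner)
    then show ?thesis
      by simp
  qed
  obtain \<Phi> where \<Phi>: "\<And>d. G d (\<Phi> d)"
    using total by metis
  have "unitary_map \<Phi>"
    unfolding unitary_map_def
  proof (intro conjI allI)
    show "\<Phi> (x + y) = \<Phi> x + \<Phi> y" for x y
      using G_unique[OF \<Phi> G_add[OF \<Phi> \<Phi>]] .
    show "\<Phi> (c *\<^sub>C x) = c *\<^sub>C \<Phi> x" for c x
      using G_unique[OF \<Phi> G_scale[OF \<Phi>]] .
    show "cinner (\<Phi> x) (\<Phi> y) = cinner x y" for x y
      using G_cinner[OF \<Phi> \<Phi>] .
    show "surj \<Phi>"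
      unfolding surj_def using onto G_unique[OF _ \<Phi>] by metis
  qed
  moreover have "\<Phi> (i x) = f x" if "x \<in> V" for x
    using G_unique[OF \<Phi> G_base[OF that]] .
  ultimately show thesis
    by (rule that)
qed

lemma unitary_map_unique:
  assumes U: "unitary_map U" and W: "unitary_map W"
    and D: "closure D = UNIV" and eq: "\<And>x. x \<in> D \<Longrightarrow> U x = W x"
  shows "U = W"
proof
  have cont: "F \<longlonglongrightarrow> F' \<Longrightarrow> (\<lambda>n. T (F n)) \<longlonglongrightarrow> T F'" if T: "unitary_map T"
    for T :: "'a \<Rightarrow> 'b" and F F'
  proof -
    assume lim: "F \<longlonglongrightarrow> F'"
    have "T (a - b) = T a - T b" for a b
    proof -
      have "T ((a - b) + b) = T (a - b) + T b"
        using T unfolding unitary_map_def by blast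
      then show ?thesis
        by simp
    qed
    moreover have "norm (T x) = norm x" for x
      using T by (simp add: unitary_map_def norm_eq_sqrt_inner inner_eq_Re_cinner)
    ultimately have "dist (T a) (T b) = dist a b" for a b
      by (simp add: dist_norm flip: \<open>\<And>a b. T (a - b) = T a - T b\<close>)
    then show ?thesis
      using lim by (simp add: tendsto_iff)
  qed
  fix x
  have "x \<in> closure D"
    using D by simp
  then obtain s where s: "\<And>n. s n \<in> D" "s \<longlonglongrightarrow> x"
    unfolding closure_sequential by blast
  then have "(\<lambda>n. U (s n)) = (\<lambda>n. W (s n))"
    using eq by auto
  then show "U x = W x"
    using cont[OF U s(2)] cont[OF W s(2)] LIMSEQ_unique by metis
qed

lemma hamiltonian_eq: "hamiltonian j = j\<inverse> O adjoint_op (j\<inverse>)"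
  by (simp add: hamiltonian_def kernel_op_def converse_relcomp adjoint_op_converse)

lemma closed_embedding_converseD:
  assumes "closed_embedding j"
  shows "linear_op (j\<inverse>)" "subspace (j\<inverse>)" "closed (j\<inverse>)" "single_valued (j\<inverse>)"
    "adjoint_op (j\<inverse>) = real_adjoint (j\<inverse>)"
proof -
  show "linear_op (j\<inverse>)"
    using assms by (simp add: closed_embedding_def linear_op_converse)
  then show "subspace (j\<inverse>)" "adjoint_op (j\<inverse>) = real_adjoint (j\<inverse>)"
    by (simp_all add: subspace_linear_op adjoint_op_eq_real_adjoint)
  show "closed (j\<inverse>)" "single_valued (j\<inverse>)"
    using assms by (simp_all add: closed_embedding_def closed_converse)
qed

text \<open>The core property approximates in the graph norm of \<open>J\<close>; its second
  component is density in the norm of the embedded space.\<close>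

lemma Domain_hamiltonian_dense:
  assumes j: "closed_embedding j"
  shows "closure (j\<inverse> `` Domain (hamiltonian j)) = UNIV"
proof -
  note J = closed_embedding_converseD[OF j]
  let ?D = "j\<inverse> `` Domain (hamiltonian j)"
  have "Domain j \<subseteq> closure ?D"
  proof
    fix p assume "p \<in> Domain j"
    then obtain x where "(x, p) \<in> j\<inverse>"
      by blast
    then have "(x, p) \<in> closure {(x, u) \<in> j\<inverse>. x \<in> Domain (hamiltonian j)}"
      using core_of_closed_operator[OF J(2-4)] by (simp add: hamiltonian_eq J(5))
    then obtain s where s: "\<And>n. s n \<in> {(x, u) \<in> j\<inverse>. x \<in> Domain (hamiltonian j)}" "s \<longlonglongrightarrow> (x, p)"
      unfolding closure_sequential by blast
    have "snd (s n) \<in> ?D" for n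
      using s(1)[of n] by (auto split: prod.splits)
    moreover have "(\<lambda>n. snd (s n)) \<longlonglongrightarrow> p"
      using tendsto_snd[OF s(2)] by simp
    ultimately show "p \<in> closure ?D"
      unfolding closure_sequential by (intro exI[of _ "\<lambda>n. snd (s n)"]) auto
  qed
  then have "closure (Domain j) \<subseteq> closure ?D"
    by (rule closure_minimal) simp
  then show ?thesis
    using j by (auto simp: closed_embedding_def densely_defined_def)
qed

text \<open>Selfadjointness turns \<open>S O S\<close> into \<open>S\<^sup>*S\<close>, so the
  comparison of forms applies to \<open>J\<close> and \<open>S\<close> in both directions.\<close>

lemma hamiltonian_Range_eq:
  assumes j: "closed_embedding j" and S: "selfadjoint_op S" "closed S" and eq: "hamiltonian j = S O S"
  shows "(p, x) \<in> j \<Longrightarrow> \<exists>u. (x, u) \<in> S \<and> norm u = norm p" "Range j = Domain S"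
proof -
  note J = closed_embedding_converseD[OF j]
  have linS: "linear_op S"
    using S by (simp add: selfadjoint_op_def)
  note S' = subspace_linear_op[OF linS] S(2) linear_opD(1)[OF linS]
  have "real_adjoint S = S"
    using S(1) adjoint_op_eq_real_adjoint[OF linS] by (simp add: selfadjoint_op_def)
  then have forms: "j\<inverse> O real_adjoint (j\<inverse>) = S O real_adjoint S"
    using eq by (simp add: hamiltonian_eq J(5))
  show 1: "\<exists>u. (x, u) \<in> S \<and> norm u = norm p" if "(p, x) \<in> j" for p x
    using that by (intro form_determines_operator_norm[OF J(2-4) S' forms]) simp
  have 2: "\<exists>p. (x, p) \<in> j\<inverse> \<and> norm p = norm u" if "(x, u) \<in> S" for x u
    using that by (intro form_determines_operator_norm[OF S' J(2-4) forms[symmetric]])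
  show "Range j = Domain S"
    using 1 2 by blast
qed

theorem theorem5p4:
  fixes H :: "('h::chilbert_space \<times> 'h) set"
    and iD :: "'h \<Rightarrow> 'd::chilbert_space"
    and iR :: "'h \<Rightarrow> 'r::chilbert_space"
  assumes "selfadjoint_op H" and "positive_op H" and "\<not> eigenvalue_op H 0"
    and "D_completion H iD" and "R_completion H iR"
  shows "(ce_triplet (D_embedding H iD) (R_embedding H iR)
        \<and> hamiltonian (D_embedding H iD) = H)
    \<and> (\<forall>(jp :: ('p::chilbert_space \<times> 'h) set) (jm :: ('h \<times> 'm::chilbert_space) set).
        ce_triplet jp jm \<and> hamiltonian jp = H \<longrightarrow>
          (dense_via (D_embedding H iD) (Domain (sqrt_op H)) \<and> dense_via jp (Domain (sqrt_op H)))
        \<and> (\<forall>x \<in> Domain (sqrt_op H). \<forall>y \<in> Domain H.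
            cinner x (op_app H y) = cinner (op_app (jp\<inverse>) x) (op_app (jp\<inverse>) y)
            \<and> cinner (op_app (jp\<inverse>) x) (op_app (jp\<inverse>) y) = D_inner H x y)
        \<and> (dense_via (D_embedding H iD) (Domain H) \<and> dense_via jp (Domain H))
        \<and> (Range jp = Domain (sqrt_op H)
            \<and> (\<forall>(p, x) \<in> jp. ennreal (norm p) =
                (SUP z \<in> {z \<in> Domain (sqrt_op H). z \<noteq> 0}.
                  ennreal (cmod (cinner x (op_app (sqrt_op H) z)) / norm z))))
        \<and> (\<exists>\<Phi> :: 'd \<Rightarrow> 'p.
            unitary_map \<Phi> \<and> (\<forall>y \<in> Domain H. (\<Phi> (iD y), y) \<in> jp)
            \<and> (\<forall>\<Psi>. unitary_map \<Psi> \<and> (\<forall>y \<in> Domain H. (\<Psi> (iD y), y) \<in> jp) \<longrightarrow> \<Psi> = \<Phi>)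
            \<and> (\<forall>y \<in> Domain H. (op_app H y, \<Phi> (iD y)) \<in> adjoint_op jp)))"
proof -
  define S where "S = sqrt_op H"
  have S: "selfadjoint_op S" "positive_op S" "S O S = H"
    unfolding S_def by (rule sqrt_op[OF assms(1,2)])+
  have linS: "linear_op S" and denseS: "closure (Domain S) = UNIV" and adjS: "adjoint_op S = S"
    using S(1) by (simp_all add: selfadjoint_op_def densely_defined_def)
  note svS = linear_opD(1)[OF linS]
  have closedS: "closed S"
    by (rule pos_selfadjointD(2)[OF pos_selfadjoint_if[OF S(1,2)]])
  have linH: "linear_op H"
    using assms(1) by (simp add: selfadjoint_op_def)
  note svH = linear_opD(1)[OF linH]
  have kerS: "x = 0" if "(x, 0) \<in> S" for x
  proof (rule ccontr)
    assume "x \<noteq> 0"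
    moreover have "(x, 0) \<in> H"
      using that linear_opD(2)[OF linS] S(3) by blast
    moreover have "0 *\<^sub>C x = 0"
      using scaleC_of_real[of 0 x] by simp
    ultimately show False
      using assms(3) by (auto simp: eigenvalue_op_def)
  qed
  have svS': "single_valued (S\<inverse>)"
  proof (rule single_valuedI)
    fix u x y assume "(u, x) \<in> S\<inverse>" "(u, y) \<in> S\<inverse>"
    then have "(x - y, 0) \<in> S"
      using linear_opD(5)[OF linS, of x u y u] by simp
    then show "x = y"
      using kerS by fastforce
  qed
  have denseR: "closure (Range S) = UNIV"
  proof (rule closure_subspace_eq_UNIV)
    have "linear (snd :: 'h \<times> 'h \<Rightarrow> 'h)"
      by (intro linearI) auto
    then show "subspace (Range S)"
      unfolding Range_snd by (intro linear_subspace_image subspace_linear_op linS)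
    fix y assume y: "y \<bullet> n = 0" if "n \<in> Range S" for n
    have "u \<bullet> y = x \<bullet> 0" if "(x, u) \<in> S" for x u
      using y[of u] that by (auto simp: inner_commute)
    then have "(y, 0) \<in> real_adjoint S"
      by (auto simp: real_adjoint_def)
    then show "y = 0"
      using adjS adjoint_op_eq_real_adjoint[OF linS] kerS by simp
  qed
  have iD: "hilbert_completion (Domain S) (\<lambda>x y. cinner (op_app S x) (op_app S y)) iD"
    using assms(4) by (simp add: D_completion_def D_inner_def[abs_def] S_def)
  have iR: "hilbert_completion (Domain (S\<inverse>)) (\<lambda>x y. cinner (op_app (S\<inverse>) x) (op_app (S\<inverse>) y)) iR"
    using assms(5) by (simp add: R_completion_def R_inner_def[abs_def] S_def)
  have linS': "linear_op (S\<inverse>)"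
    by (rule linear_op_converse[OF linS svS'])

  \<comment> \<open>The triplet built from the two completions\<close>
  define jD where "jD = D_embedding H iD"
  define jR where "jR = R_embedding H iR"
  have jD_eq: "jD = {(iD x, x) | x. x \<in> Domain S}"
    by (simp add: jD_def D_embedding_def S_def)
  \<comment> \<open>Read backwards, \<open>jR\<close> is the completion embedding belonging to the
    inverse of \<open>S\<close>.\<close>
  have jR_eq: "jR = {(iR u, u) | u. u \<in> Domain (S\<inverse>)}\<inverse>"
    by (auto simp: jR_def R_embedding_def S_def)
  have jD: "closed_embedding jD"
    unfolding jD_eq by (rule closed_embedding_completion[OF linS iD closedS svS' denseS])
  have Range_jD: "Range jD = Domain S"
    by (auto simp: jD_eq)
  have Domain_jD: "Domain jD = iD ` Domain S"
    by (auto simp: jD_eq)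
  have "closed_embedding {(iR u, u) | u. u \<in> Domain (S\<inverse>)}"
    using svS denseR by (intro closed_embedding_completion[OF linS' iR closed_converse[OF closedS]]) simp_all
  moreover have "Range {(iR u, u) | u. u \<in> Domain (S\<inverse>)} = Range S"
    by auto
  ultimately have jR: "closed_embedding jR"
    unfolding jR_eq using denseR by (intro closed_embedding_converse) simp_all
  have Domain_jR: "Domain jR = Range S"
    by (auto simp: jR_eq)
  have "Range jR = iR ` Domain (S\<inverse>)"
    by (auto simp: jR_eq)
  then have Range_jR: "closure (Range jR) = UNIV"
    using iR by (simp add: hilbert_completion_def)
  have adj_jD: "(y, z) \<in> adjoint_op jD \<longleftrightarrow> (\<forall>x \<in> Domain S. cinner x y = cinner (iD x) z)" for y z
    by (auto simp: adjoint_op_def jD_eq)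
  have "Domain (adjoint_op jD) \<subseteq> Domain jR"
  proof
    fix y assume "y \<in> Domain (adjoint_op jD)"
    then obtain z where z: "(y, z) \<in> adjoint_op jD"
      by blast
    \<comment> \<open>The vector \<open>z\<close> of the completion is replaced by a vector
      \<open>g\<close> of the original space; the adjoint relation for \<open>jD\<close> then says
      that \<open>S g = y\<close>.\<close>
    obtain g where g: "\<And>x u. (x, u) \<in> S \<Longrightarrow> cinner (iD x) z = cinner u g"
      using completion_represent[OF linS iD, of z] by blast
    have "cinner u g = cinner x y" if "(x, u) \<in> S" for x u
      using z g[OF that] that unfolding adj_jD by (metis Domain.DomainI)
    then have "(g, y) \<in> adjoint_op S"
      by (auto simp: adjoint_op_def)
    then show "y \<in> Domain jR"
      unfolding adjS Domain_jR by blast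
  qed
  moreover have "ennreal (norm v) = (SUP (x, u) \<in> {(x, u) \<in> jD. x \<noteq> 0}. ennreal (cmod (cinner u y) / norm x))"
    if "(y, v) \<in> jR" for y v
  proof -
    have "y \<in> Range S" and v: "v = iR y"
      using that by (auto simp: jR_eq)
    then obtain g where g: "(g, y) \<in> S"
      by blast
    \<comment> \<open>With \<open>y = S g\<close> one has \<open>cinner x y = cinner (S x) g\<close>
      and \<open>norm (iD x) = norm (S x)\<close>, so the required supremum is the dual norm of
      \<open>g\<close> over the dense set \<open>Ran S\<close>.\<close>
    then have "norm v = norm g"
      using completion_norm[OF linS' iR, of y g] v by simp
    also have "ennreal (norm g) = (SUP w \<in> {w \<in> Range S. w \<noteq> 0}. ennreal (cmod (cinner w g) / norm w))"
      by (rule norm_eq_SUP[OF denseR])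
    also have "(\<lambda>w. ennreal (cmod (cinner w g) / norm w)) ` {w \<in> Range S. w \<noteq> 0}
        = (\<lambda>(x, u). ennreal (cmod (cinner u y) / norm x)) ` {(x, u) \<in> jD. x \<noteq> 0}"
    proof -
      have *: "cinner x y = cinner w g \<and> norm (iD x) = norm w" if "(x, w) \<in> S" for x w
        using adjoint_opD[of g y S x w] completion_norm[OF linS iD that] that g(1) adjS by simp
      show ?thesis
      proof
        show "(\<lambda>w. ennreal (cmod (cinner w g) / norm w)) ` {w \<in> Range S. w \<noteq> 0}
          \<subseteq> (\<lambda>(x, u). ennreal (cmod (cinner u y) / norm x)) ` {(x, u) \<in> jD. x \<noteq> 0}"
        proof clarify
          fix x w assume xw: "(x, w) \<in> S" "w \<noteq> 0"
          then have "(iD x, x) \<in> {(x, u) \<in> jD. x \<noteq> 0}"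
            using *[OF xw(1)] by (auto simp: jD_eq)
          then show "ennreal (cmod (cinner w g) / norm w)
              \<in> (\<lambda>(x, u). ennreal (cmod (cinner u y) / norm x)) ` {(x, u) \<in> jD. x \<noteq> 0}"
            using *[OF xw(1)] by (intro image_eqI[where x = "(iD x, x)"]) auto
        qed
        show "(\<lambda>(x, u). ennreal (cmod (cinner u y) / norm x)) ` {(x, u) \<in> jD. x \<noteq> 0}
          \<subseteq> (\<lambda>w. ennreal (cmod (cinner w g) / norm w)) ` {w \<in> Range S. w \<noteq> 0}"
        proof clarify
          fix p x assume px: "(p, x) \<in> jD" "p \<noteq> 0"
          then obtain w where w: "(x, w) \<in> S" "p = iD x"
            by (auto simp: jD_eq)
          then show "ennreal (cmod (cinner x y) / norm p)
              \<in> (\<lambda>w. ennreal (cmod (cinner w g) / norm w)) ` {w \<in> Range S. w \<noteq> 0}"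
            using *[OF w(1)] px(2) by (intro image_eqI[where x = w]) auto
        qed
      qed
    qed
    finally show ?thesis .
  qed
  ultimately have triplet: "ce_triplet jD jR"
    using jD jR Range_jR Range_jD denseS by (auto simp: ce_triplet_def)
  have ham: "hamiltonian jD = H"
  proof -
    have "(x, y) \<in> hamiltonian jD \<longleftrightarrow> (x, y) \<in> S O S" for x y
    proof
      assume "(x, y) \<in> hamiltonian jD"
      then have x: "x \<in> Domain S" and "(y, iD x) \<in> adjoint_op jD"
        by (auto simp: hamiltonian_def kernel_op_def jD_eq)
      then obtain w where w: "(x, w) \<in> S"
        by blast
      have "cinner u w = cinner a y" if "(a, u) \<in> S" for a u
        using \<open>(y, iD x) \<in> adjoint_op jD\<close> completion_cinner[OF linS iD that w] that
        unfolding adj_jD by (metis Domain.DomainI)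
      then have "(w, y) \<in> adjoint_op S"
        by (auto simp: adjoint_op_def)
      then show "(x, y) \<in> S O S"
        using w adjS by blast
    next
      assume "(x, y) \<in> S O S"
      then obtain w where w: "(x, w) \<in> S" "(w, y) \<in> S"
        by blast
      have "cinner a y = cinner (iD a) (iD x)" if "(a, u) \<in> S" for a u
        using completion_cinner[OF linS iD that w(1)] adjoint_opD[of w y S a u] that w(2) adjS by simp
      then have "(y, iD x) \<in> adjoint_op jD"
        unfolding adj_jD by blast
      moreover have "(iD x, x) \<in> jD"
        using w by (auto simp: jD_eq)
      ultimately show "(x, y) \<in> hamiltonian jD"
        by (auto simp: hamiltonian_def kernel_op_def)
    qed
    then show ?thesis
      using S(3) by auto
  qed
  have H_sub: "Domain H \<subseteq> Domain S"
    using S(3) by blast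
  have D_inner: "D_inner H x y = cinner u v" if "(x, u) \<in> S" "(y, v) \<in> S" for x y u v
    using that by (simp add: D_inner_def op_app_eq[OF svS] flip: S_def)
  have "jD\<inverse> `` Domain S = iD ` Domain S"
    by (auto simp: jD_eq)
  then have dense_DS: "dense_via jD (Domain S)"
    using iD by (simp add: dense_via_def Range_jD hilbert_completion_def)
  have dense_DH: "dense_via jD (Domain H)"
    using Domain_hamiltonian_dense[OF jD] H_sub by (simp add: dense_via_def Range_jD ham)
  have "jD\<inverse> `` Domain H = iD ` Domain H"
    using H_sub unfolding jD_eq by blast
  then have dense_iDH: "closure (iD ` Domain H) = UNIV"
    using dense_DH by (simp add: dense_via_def)

  \<comment> \<open>Arbitrary triplets with Hamiltonian \<open>H\<close>\<close>
  have second: "(dense_via jD (Domain S) \<and> dense_via jp (Domain S))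
        \<and> (\<forall>x \<in> Domain S. \<forall>y \<in> Domain H.
            cinner x (op_app H y) = cinner (op_app (jp\<inverse>) x) (op_app (jp\<inverse>) y)
            \<and> cinner (op_app (jp\<inverse>) x) (op_app (jp\<inverse>) y) = D_inner H x y)
        \<and> (dense_via jD (Domain H) \<and> dense_via jp (Domain H))
        \<and> (Range jp = Domain S
            \<and> (\<forall>(p, x) \<in> jp. ennreal (norm p) =
                (SUP z \<in> {z \<in> Domain S. z \<noteq> 0}.
                  ennreal (cmod (cinner x (op_app S z)) / norm z))))
        \<and> (\<exists>\<Phi> :: 'd \<Rightarrow> 'p.
            unitary_map \<Phi> \<and> (\<forall>y \<in> Domain H. (\<Phi> (iD y), y) \<in> jp)
            \<and> (\<forall>\<Psi>. unitary_map \<Psi> \<and> (\<forall>y \<in> Domain H. (\<Psi> (iD y), y) \<in> jp) \<longrightarrow> \<Psi> = \<Phi>)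
            \<and> (\<forall>y \<in> Domain H. (op_app H y, \<Phi> (iD y)) \<in> adjoint_op jp))"
    if trip: "ce_triplet jp jm" and ham_jp: "hamiltonian jp = H"
    for jp :: "('p \<times> 'h) set" and jm :: "('h \<times> 'm) set"
  proof -
    have jp: "closed_embedding jp"
      using trip by (simp add: ce_triplet_def)
    note J = closed_embedding_converseD[OF jp]
    define J where "J = op_app (jp\<inverse>)"
    have J_eq: "J x = p" if "(p, x) \<in> jp" for p x
      unfolding J_def using that by (intro op_app_eq J(4)) simp
    have norm_jp: "\<exists>u. (x, u) \<in> S \<and> norm u = norm p" if "(p, x) \<in> jp" for p x
      using hamiltonian_Range_eq(1)[OF jp S(1) closedS] that ham_jp S(3) by simp
    have Range_jp: "Range jp = Domain S"
      using hamiltonian_Range_eq(2)[OF jp S(1) closedS] ham_jp S(3) by simp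
    have J_mem: "(J x, x) \<in> jp" if x: "x \<in> Domain S" for x
    proof -
      obtain p where "(p, x) \<in> jp"
        using x Range_jp by blast
      then show ?thesis
        using J_eq by simp
    qed
    \<comment> \<open>As \<open>H\<close> is the inverse of \<open>jp\<close> after its adjoint, the
      intermediate vector of that composition is \<open>J y = j\<^sub>+\<^sup>* H y\<close>. This
      yields both the form identity and the formula for \<Phi>.\<close>
    have J_adj: "(op_app H y, J y) \<in> adjoint_op jp" if y: "y \<in> Domain H" for y
    proof -
      obtain h where "(y, h) \<in> H"
        using y by blast
      moreover from this obtain p where "(p, y) \<in> jp" "(h, p) \<in> adjoint_op jp"
        using ham_jp by (auto simp: hamiltonian_def kernel_op_def)
      ultimately show ?thesis
        using J_eq op_app_eq[OF svH] by simp
    qed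
    have form: "cinner x (op_app H y) = cinner (J x) (J y)" "cinner (J x) (J y) = D_inner H x y"
      if xy: "x \<in> Domain S" "y \<in> Domain H" for x y
    proof -
      show 1: "cinner x (op_app H y) = cinner (J x) (J y)"
        by (rule adjoint_opD[OF J_adj[OF xy(2)] J_mem[OF xy(1)]])
      obtain u where u: "(x, u) \<in> S"
        using xy by blast
      obtain h where h: "(y, h) \<in> H"
        using xy by blast
      then obtain v where v: "(y, v) \<in> S" "(v, h) \<in> S"
        using S(3) by blast
      have "cinner u v = cinner x h"
        using adjoint_opD[of v h S x u] v(2) u adjS by simp
      then show "cinner (J x) (J y) = D_inner H x y"
        using D_inner[OF u v(1)] op_app_eq[OF svH h] 1 by simp
    qed
    have "jp\<inverse> `` Domain S = Domain jp"
      using Range_jp by blast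
    then have dense_S: "dense_via jp (Domain S)"
      using jp by (simp add: dense_via_def Range_jp closed_embedding_def densely_defined_def)
    have dense_H: "dense_via jp (Domain H)"
      using Domain_hamiltonian_dense[OF jp] H_sub by (simp add: dense_via_def Range_jp ham_jp)
    have sup: "\<forall>(p, x) \<in> jp. ennreal (norm p) = (SUP z \<in> {z \<in> Domain S. z \<noteq> 0}.
        ennreal (cmod (cinner x (op_app S z)) / norm z))"
    proof clarify
      fix p x assume px: "(p, x) \<in> jp"
      obtain u where u: "(x, u) \<in> S" "norm u = norm p"
        using norm_jp[OF px] by blast
      \<comment> \<open>Moving \<open>S\<close> onto \<open>x\<close> turns the supremum into the
        dual norm of \<open>u = S x\<close>, which equals the norm of \<open>p\<close>.\<close>
      have "cmod (cinner x (op_app S z)) = cmod (cinner z u)" if z: "z \<in> Domain S" for z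
      proof -
        obtain w where w: "(z, w) \<in> S"
          using z by blast
        have "cinner u z = cinner x w"
          using adjoint_opD[of z w S x u] w u(1) adjS by simp
        then show ?thesis
          using op_app_eq[OF svS w] cinner_commute[of u z] by (metis complex_mod_cnj)
      qed
      then have "(SUP z \<in> {z \<in> Domain S. z \<noteq> 0}. ennreal (cmod (cinner x (op_app S z)) / norm z))
          = (SUP z \<in> {z \<in> Domain S. z \<noteq> 0}. ennreal (cmod (cinner z u) / norm z))"
        by (intro SUP_cong) auto
      then show "ennreal (norm p) = (SUP z \<in> {z \<in> Domain S. z \<noteq> 0}.
          ennreal (cmod (cinner x (op_app S z)) / norm z))"
        using norm_eq_SUP[OF denseS, of u] u(2) by simp
    qed
    \<comment> \<open>By density, \<open>iD\<close> restricted to \<open>Domain H\<close> is still a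
      completion; \<open>J\<close> is a second one for the same inner product, and \<Phi> compares
      the two.\<close>
    have iDH: "hilbert_completion (Domain H) (D_inner H) iD"
      using assms(4) dense_iDH H_sub
      unfolding D_completion_def hilbert_completion_def S_def[symmetric] by (simp add: subset_iff)
    have lin_jp: "linear_op jp"
      using jp by (simp add: closed_embedding_def)
    have J_mem_H: "(J x, x) \<in> jp" if "x \<in> Domain H" for x
      using J_mem H_sub that by blast
    have J_completion: "hilbert_completion (Domain H) (D_inner H) J"
      unfolding hilbert_completion_def
    proof (intro conjI ballI allI)
      fix x y c assume x: "x \<in> Domain H"
      then show "J (c *\<^sub>C x) = c *\<^sub>C J x"
        by (intro J_eq linear_opD(4)[OF lin_jp] J_mem_H)
      assume y: "y \<in> Domain H"
      show "J (x + y) = J x + J y"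
        by (intro J_eq linear_opD(3)[OF lin_jp] J_mem_H x y)
      show "cinner (J x) (J y) = D_inner H x y"
        using form(2) x y H_sub by blast
    next
      have "jp\<inverse> `` Domain H = J ` Domain H"
        using J_mem_H J_eq by blast
      then show "closure (J ` Domain H) = UNIV"
        using dense_H by (simp add: dense_via_def)
    qed
    obtain \<Phi> where \<Phi>: "unitary_map \<Phi>" "\<And>x. x \<in> Domain H \<Longrightarrow> \<Phi> (iD x) = J x"
      using hilbert_completion_unitary[OF iDH J_completion] linear_opD(3,4)[OF linH]
      by (metis (no_types, lifting) DomainE Domain.DomainI)
    have \<Phi>_unique: "\<Psi> = \<Phi>" if \<Psi>: "unitary_map \<Psi>" "\<forall>y \<in> Domain H. (\<Psi> (iD y), y) \<in> jp" for \<Psi>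
    proof (rule unitary_map_unique[OF \<Psi>(1) \<Phi>(1) dense_iDH])
      fix p assume "p \<in> iD ` Domain H"
      then obtain y where "y \<in> Domain H" "p = iD y"
        by blast
      then show "\<Psi> p = \<Phi> p"
        using \<Psi>(2) \<Phi>(2) J_eq by metis
    qed
    have \<Phi>_jp: "(\<Phi> (iD y), y) \<in> jp" "(op_app H y, \<Phi> (iD y)) \<in> adjoint_op jp" if "y \<in> Domain H" for y
      using that \<Phi>(2) J_mem_H J_adj by simp_all
    have ex: "\<exists>\<Phi> :: 'd \<Rightarrow> 'p.
            unitary_map \<Phi> \<and> (\<forall>y \<in> Domain H. (\<Phi> (iD y), y) \<in> jp)
            \<and> (\<forall>\<Psi>. unitary_map \<Psi> \<and> (\<forall>y \<in> Domain H. (\<Psi> (iD y), y) \<in> jp) \<longrightarrow> \<Psi> = \<Phi>)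
            \<and> (\<forall>y \<in> Domain H. (op_app H y, \<Phi> (iD y)) \<in> adjoint_op jp)"
    proof (intro exI[of _ \<Phi>] conjI ballI allI impI)
      show "\<Psi> = \<Phi>" if "unitary_map \<Psi> \<and> (\<forall>y \<in> Domain H. (\<Psi> (iD y), y) \<in> jp)" for \<Psi>
        using that by (intro \<Phi>_unique) blast+
    qed (fact \<Phi>(1) \<Phi>_jp)+
    have forms: "\<forall>x \<in> Domain S. \<forall>y \<in> Domain H.
        cinner x (op_app H y) = cinner (J x) (J y) \<and> cinner (J x) (J y) = D_inner H x y"
      by (intro ballI conjI form)
    show ?thesis
      unfolding J_def[symmetric]
      by (intro conjI dense_DS dense_S forms dense_DH dense_H Range_jp sup ex)
  qed
  show ?thesis
    unfolding S_def[symmetric] jD_def[symmetric] jR_def[symmetric]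
    by (intro conjI[OF conjI[OF triplet ham]] allI impI, elim conjE, rule second)
qed

end
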